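(* For every $\gamma>0$, $m\ge1$, $\mathcal{E}>0$ and $N\ge2$, $$\lambda^{*,m}_{LR}(\mathcal{E},N)\ \ge\ \frac{\mathcal{E}^m\kappa_m}{2}\,\lambda^{*,0}_{LR}(\mathcal{E},N).$$
   Context: Fix $\gamma>0$. $\nu^{\gamma}(dx)=x^{\gamma-1}e^{-x}\Gamma(\gamma)^{-1}dx$ on $(0,\infty)$; $\mathcal{S}_{\mathcal{E},N}=\{x\in(0,\infty)^N:\frac1N\sum_i x_i=\mathcal{E}\}$; $\nu_{\mathcal{E},N}=\nu^\gamma_{\mathcal{E},N}$ is the conditional law of $(\nu^\gamma)^{\otimes N}$ on $\mathcal{S}_{\mathcal{E},N}$. $\mu^\gamma$ is the Beta$(\gamma,\gamma)$ law on $[0,1]$. $T_{i,j,\alpha}x$ replaces $x_i$ by $\alpha(x_i+x_j)$ and $x_j$ by $(1-\alpha)(x_i+x_j)$. $E_{i,j}f(x)=\int\mu^\gamma(d\alpha)f(T_{i,j,\alpha}x)$, $D_{i,j}f=E_{i,j}f-f$. $\mathcal{D}^{*,m}_{\mathcal{E},N}(f)=\sum_{i=1}^{N-1}E_{\nu_{\mathcal{E},N}}[(x_i+x_{i+1})^m(D_{i,i+1}f)^2]$; $\mathcal{D}^{*,m}_{LR,\mathcal{E},N}(f)=\frac1N\sum_{1\le i<j\le N}E_{\nu_{\mathcal{E},N}}[(x_i+x_j)^m(D_{i,j}f)^2]$. $\lambda^{*,m}(\mathcal{E},N)$, resp. $\lambda^{*,m}_{LR}(\mathcal{E},N)$, is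 the infimum of the corresponding Dirichlet form divided by $E_{\nu_{\mathcal{E},N}}[f^2]$ over nonzero mean-zero $f\in L^2(\nu_{\mathcal{E},N})$. $\kappa_m=\lambda^{*,m}(\frac13,3)$. *)

theory Defs
  imports "HOL-Probability.Probability"
begin

text \<open>Points of (0,inf)^N are represented as extensional functions
  x :: nat => real on the index set {..<N} (0-based: index k here is
  index k+1 in the paper).\<close>

definition cfg_space :: "nat \<Rightarrow> (nat \<Rightarrow> real) measure" where
  "cfg_space N = PiM {..<N} (\<lambda>_. lborel)"

definition beta_dens :: "real \<Rightarrow> real \<Rightarrow> real" where
  "beta_dens \<gamma> a = indicator {0<..<1} a * (a powr (\<gamma> - 1) * (1 - a) powr (\<gamma> - 1))"

definition mu_beta :: "real \<Rightarrow> real measure" where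
  "mu_beta \<gamma> = density lborel
     (\<lambda>a. ennreal (beta_dens \<gamma> a) / (\<integral>\<^sup>+ b. ennreal (beta_dens \<gamma> b) \<partial>lborel))"

text \<open>The conditional law nu_{E,N} of the product Gamma(gamma) measure on the
  simplex {x in (0,inf)^N : (1/N) sum x_i = E}: the first N-1 coordinates have
  Lebesgue density proportional to prod_{i<N} x_i^(gamma-1) on the region where
  all coordinates (including x_{N-1} = N E - sum_{i<N-1} x_i) are positive.\<close>
definition last_coord :: "real \<Rightarrow> nat \<Rightarrow> (nat \<Rightarrow> real) \<Rightarrow> real" where
  "last_coord \<E> N y = real N * \<E> - (\<Sum>i<N - 1. y i)"

definition simplex_dens :: "real \<Rightarrow> real \<Rightarrow> nat \<Rightarrow> (nat \<Rightarrow> real) \<Rightarrow> real" where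
  "simplex_dens \<gamma> \<E> N y =
     (if (\<forall>i<N - 1. 0 < y i) \<and> 0 < last_coord \<E> N y
      then (\<Prod>i<N - 1. y i powr (\<gamma> - 1)) * last_coord \<E> N y powr (\<gamma> - 1)
      else 0)"

definition complete_cfg :: "real \<Rightarrow> nat \<Rightarrow> (nat \<Rightarrow> real) \<Rightarrow> (nat \<Rightarrow> real)" where
  "complete_cfg \<E> N y = restrict (y(N - 1 := last_coord \<E> N y)) {..<N}"

definition nu_cond :: "real \<Rightarrow> real \<Rightarrow> nat \<Rightarrow> (nat \<Rightarrow> real) measure" where
  "nu_cond \<gamma> \<E> N =
     distr (density (PiM {..<N - 1} (\<lambda>_. lborel))
              (\<lambda>y. ennreal (simplex_dens \<gamma> \<E> N y) /
                   (\<integral>\<^sup>+ z. ennreal (simplex_dens \<gamma> \<E> N z) \<partial>(PiM {..<N - 1} (\<lambda>_. lborel)))))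
           (cfg_space N) (complete_cfg \<E> N)"

definition T_op :: "nat \<Rightarrow> nat \<Rightarrow> real \<Rightarrow> (nat \<Rightarrow> real) \<Rightarrow> (nat \<Rightarrow> real)" where
  "T_op i j \<alpha> x = x(i := \<alpha> * (x i + x j), j := (1 - \<alpha>) * (x i + x j))"

definition E_op :: "real \<Rightarrow> nat \<Rightarrow> nat \<Rightarrow> ((nat \<Rightarrow> real) \<Rightarrow> real) \<Rightarrow> (nat \<Rightarrow> real) \<Rightarrow> real" where
  "E_op \<gamma> i j f x = (\<integral>\<alpha>. f (T_op i j \<alpha> x) \<partial>(mu_beta \<gamma>))"

definition D_op :: "real \<Rightarrow> nat \<Rightarrow> nat \<Rightarrow> ((nat \<Rightarrow> real) \<Rightarrow> real) \<Rightarrow> (nat \<Rightarrow> real) \<Rightarrow> real" where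
  "D_op \<gamma> i j f x = E_op \<gamma> i j f x - f x"

definition dir_nn :: "real \<Rightarrow> real \<Rightarrow> real \<Rightarrow> nat \<Rightarrow> ((nat \<Rightarrow> real) \<Rightarrow> real) \<Rightarrow> ennreal" where
  "dir_nn \<gamma> m \<E> N f =
     (\<Sum>i<N - 1. \<integral>\<^sup>+ x. ennreal ((x i + x (i + 1)) powr m * (D_op \<gamma> i (i + 1) f x)\<^sup>2)
                     \<partial>(nu_cond \<gamma> \<E> N))"

definition dir_lr :: "real \<Rightarrow> real \<Rightarrow> real \<Rightarrow> nat \<Rightarrow> ((nat \<Rightarrow> real) \<Rightarrow> real) \<Rightarrow> ennreal" where
  "dir_lr \<gamma> m \<E> N f =
     ennreal (1 / real N) *
     (\<Sum>(i, j) \<in> {(i, j). i < j \<and> j < N}.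
        \<integral>\<^sup>+ x. ennreal ((x i + x j) powr m * (D_op \<gamma> i j f x)\<^sup>2) \<partial>(nu_cond \<gamma> \<E> N))"

definition test_fns :: "real \<Rightarrow> real \<Rightarrow> nat \<Rightarrow> ((nat \<Rightarrow> real) \<Rightarrow> real) set" where
  "test_fns \<gamma> \<E> N =
     {f. f \<in> borel_measurable (cfg_space N)
         \<and> integrable (nu_cond \<gamma> \<E> N) (\<lambda>x. (f x)\<^sup>2)
         \<and> (\<integral>x. f x \<partial>(nu_cond \<gamma> \<E> N)) = 0
         \<and> (\<integral>x. (f x)\<^sup>2 \<partial>(nu_cond \<gamma> \<E> N)) \<noteq> 0}"

definition gap_nn :: "real \<Rightarrow> real \<Rightarrow> real \<Rightarrow> nat \<Rightarrow> ennreal" where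
  "gap_nn \<gamma> m \<E> N =
     (INF f \<in> test_fns \<gamma> \<E> N. dir_nn \<gamma> m \<E> N f / ennreal (\<integral>x. (f x)\<^sup>2 \<partial>(nu_cond \<gamma> \<E> N)))"

definition gap_lr :: "real \<Rightarrow> real \<Rightarrow> real \<Rightarrow> nat \<Rightarrow> ennreal" where
  "gap_lr \<gamma> m \<E> N =
     (INF f \<in> test_fns \<gamma> \<E> N. dir_lr \<gamma> m \<E> N f / ennreal (\<integral>x. (f x)\<^sup>2 \<partial>(nu_cond \<gamma> \<E> N)))"

definition kappa :: "real \<Rightarrow> real \<Rightarrow> ennreal" where
  "kappa \<gamma> m = gap_nn \<gamma> m (1 / 3) 3"

end

theory Submission
  imports Defs
begin

text \<open>The conditional law is invariant under resampling a pair \<open>(i, j)\<close> by a symmetric Beta variable, and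
  under resampling a triple \<open>(i, j, l)\<close>: its total mass \<open>s\<close> is kept and redistributed according to
  \<open>nu_cond \<gamma> (1 / 3) 3\<close>. Applying the definition of \<open>\<kappa>\<close> on each triple, with the scaling factor \<open>s powr m\<close>,
  and using that \<open>D_op\<close> is an \<open>L\<^sup>2\<close> contraction, one gets
  \<open>\<kappa> E[s powr m (D_ij f)\<^sup>2] \<le> E[(x_i + x_j) powr m (D_ij f)\<^sup>2] + E[(x_j + x_l) powr m (D_jl f)\<^sup>2]\<close>.
  Summing over all ordered triples, each pair occurs \<open>2 (N - 2)\<close> times on the right, while convexity gives
  \<open>\<Sum>l. (x_i + x_j + x_l) powr m \<ge> (N - 2) \<E> powr m\<close> on the left. For \<open>N = 2\<close> there are no triples, and
  the bound \<open>\<kappa> \<le> 2\<close> suffices.\<close>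

subsection \<open>Beta and Gamma weights\<close>

text \<open>A third site helps because the totals of all triples containing the pair cannot be small
  together. Of the three-site variance that \<open>kappa\<close> controls, only the part seen by
  \<open>D_op\<close> on one pair is kept; these parts add up to the form with exponent 0. The 2 in
  the final constant is the number of bonds of the three-site chain, which is also where
  \<open>kappa_le_2\<close> gets its bound. The encoding of \<open>nu_cond\<close> by a density in
  the first \<open>N - 1\<close> coordinates shapes the rest: invariance is directly visible only
  for pairs and triples containing the last site, and transpositions carry it to the others. The
  normalising constant is common to both sides of an invariance and is evaluated for three sites
  only. Estimates use nonnegative integrals, so infinite values do no harm.\<close>

text \<open>On the simplex the factor \<open>exp (- x)\<close> of the Gamma density contributes only a constant, so it is dropped.\<close>

definition gamma_weight :: "real \<Rightarrow> real \<Rightarrow> real" where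
  "gamma_weight \<gamma> u = (if 0 < u then u powr (\<gamma> - 1) else 0)"

lemma gamma_weight_nonneg [simp]: "0 \<le> gamma_weight \<gamma> u"
  by (simp add: gamma_weight_def)

lemma gamma_weight_measurable [measurable]: "gamma_weight \<gamma> \<in> borel_measurable borel"
  unfolding gamma_weight_def by measurable

lemma gamma_weight_scale: "0 < t \<Longrightarrow> gamma_weight \<gamma> (t * u) = t powr (\<gamma> - 1) * gamma_weight \<gamma> u"
  by (auto simp: gamma_weight_def powr_mult zero_less_mult_iff)

lemma beta_dens_eq_gamma_weight: "beta_dens \<gamma> a = gamma_weight \<gamma> a * gamma_weight \<gamma> (1 - a)"
  by (auto simp: beta_dens_def gamma_weight_def indicator_def)

lemma simplex_dens_eq_gamma_weight:
  "simplex_dens \<gamma> \<E> N y = (\<Prod>i<N - 1. gamma_weight \<gamma> (y i)) * gamma_weight \<gamma> (last_coord \<E> N y)"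
  by (auto simp: simplex_dens_def gamma_weight_def intro!: prod.cong)

text \<open>The second parameter is free because the three-site mass involves
  \<open>Beta \<gamma> (2 * \<gamma>)\<close>, while a pair involves
  \<open>Beta \<gamma> \<gamma>\<close>.\<close>

lemma nn_integral_gamma_weight_Beta:
  assumes "\<gamma> > 0" "\<delta> > 0"
  shows "(\<integral>\<^sup>+ u. ennreal (gamma_weight \<gamma> u * gamma_weight \<delta> (1 - u)) \<partial>lborel) = ennreal (Beta \<gamma> \<delta>)"
proof -
  have "((\<lambda>u. u powr (\<gamma> - 1) * (1 - u) powr (\<delta> - 1)) has_integral Beta \<gamma> \<delta>) {0<..<1}"
    using has_integral_Beta_real[OF assms] by (simp add: has_integral_Icc_iff_Ioo)
  then have "((\<lambda>u. gamma_weight \<gamma> u * gamma_weight \<delta> (1 - u)) has_integral Beta \<gamma> \<delta>) {0<..<1}"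
    by (rule has_integral_eq_rhs[OF has_integral_eq, rotated]) (auto simp: gamma_weight_def)
  then have "((\<lambda>u. gamma_weight \<gamma> u * gamma_weight \<delta> (1 - u)) has_integral Beta \<gamma> \<delta>) UNIV"
    by (rule has_integral_on_superset) (auto simp: gamma_weight_def)
  then show ?thesis
    using nn_integral_has_integral_lborel[of "\<lambda>u. gamma_weight \<gamma> u * gamma_weight \<delta> (1 - u)" "Beta \<gamma> \<delta>"] by simp
qed

lemma Beta_real_pos: "a > 0 \<Longrightarrow> b > 0 \<Longrightarrow> Beta a b > (0::real)"
  by (simp add: Beta_def)

lemma mu_beta_eq:
  assumes "\<gamma> > 0"
  shows "mu_beta \<gamma> = density lborel (\<lambda>a. ennreal (gamma_weight \<gamma> a * gamma_weight \<gamma> (1 - a) / Beta \<gamma> \<gamma>))"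
  using Beta_real_pos[OF assms assms]
  by (simp add: mu_beta_def beta_dens_eq_gamma_weight nn_integral_gamma_weight_Beta assms divide_ennreal)

lemma sets_mu_beta [simp, measurable_cong]: "sets (mu_beta \<gamma>) = sets borel"
  by (simp add: mu_beta_def)

lemma space_mu_beta [simp]: "space (mu_beta \<gamma>) = UNIV"
  by (simp add: mu_beta_def)

lemma nn_integral_mu_beta:
  assumes "\<gamma> > 0" and [measurable]: "\<phi> \<in> borel_measurable borel"
  shows "(\<integral>\<^sup>+ a. \<phi> a \<partial>mu_beta \<gamma>) * ennreal (Beta \<gamma> \<gamma>) =
    (\<integral>\<^sup>+ a. ennreal (gamma_weight \<gamma> a * gamma_weight \<gamma> (1 - a)) * \<phi> a \<partial>lborel)"
proof -
  have *: "ennreal (g / Beta \<gamma> \<gamma>) * p * ennreal (Beta \<gamma> \<gamma>) = ennreal g * p" if "g \<ge> 0" for g p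
  proof -
    have "ennreal (g / Beta \<gamma> \<gamma>) * ennreal (Beta \<gamma> \<gamma>) = ennreal g"
      using Beta_real_pos[OF assms(1) assms(1)] that by (subst ennreal_mult[symmetric]) auto
    then show ?thesis
      by (simp add: ac_simps)
  qed
  show ?thesis
    by (subst nn_integral_multc[symmetric])
       (simp_all add: mu_beta_eq assms nn_integral_density mult.assoc *[unfolded mult.assoc])
qed

lemma prob_space_mu_beta: "\<gamma> > 0 \<Longrightarrow> prob_space (mu_beta \<gamma>)"
proof (rule prob_spaceI)
  assume g: "\<gamma> > 0"
  have "(\<integral>\<^sup>+ a. 1 \<partial>mu_beta \<gamma>) * ennreal (Beta \<gamma> \<gamma>) = 1 * ennreal (Beta \<gamma> \<gamma>)"
    using nn_integral_mu_beta[OF g, of "\<lambda>_. 1"] nn_integral_gamma_weight_Beta[OF g g] by simp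
  then have "(\<integral>\<^sup>+ a. 1 \<partial>mu_beta \<gamma>) = 1"
    using Beta_real_pos[OF g g]
    by (simp only: mult.commute[of _ "ennreal (Beta \<gamma> \<gamma>)"] ennreal_mult_cancel_left) auto
  then show "emeasure (mu_beta \<gamma>) (space (mu_beta \<gamma>)) = 1"
    by simp
qed

lemma nn_integral_mu_beta_flip:
  assumes "\<gamma> > 0" and [measurable]: "\<phi> \<in> borel_measurable borel"
  shows "(\<integral>\<^sup>+ a. \<phi> (1 - a) \<partial>mu_beta \<gamma>) = (\<integral>\<^sup>+ a. \<phi> a \<partial>mu_beta \<gamma>)"
proof -
  have "(\<integral>\<^sup>+ a. \<phi> a \<partial>mu_beta \<gamma>) = 
     (\<integral>\<^sup>+ a. ennreal (gamma_weight \<gamma> a * gamma_weight \<gamma> (1 - a) / Beta \<gamma> \<gamma>) * \<phi> a \<partial>lborel)"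
    by (simp add: mu_beta_eq assms nn_integral_density)
  also have "\<dots> = (\<integral>\<^sup>+ a. ennreal (gamma_weight \<gamma> (1 - a) * gamma_weight \<gamma> a / Beta \<gamma> \<gamma>) * \<phi> (1 - a) \<partial>lborel)"
    by (subst nn_integral_real_affine[where c = "-1" and t = 1]) auto
  also have "\<dots> = (\<integral>\<^sup>+ a. \<phi> (1 - a) \<partial>mu_beta \<gamma>)"
    by (simp add: mu_beta_eq assms nn_integral_density mult.commute)
  finally show ?thesis ..
qed

text \<open>This symmetry makes \<open>D_op \<gamma> i j\<close> and
  \<open>D_op \<gamma> j i\<close> agree, so that sums over ordered and unordered pairs can be
  exchanged.\<close>

lemma distr_mu_beta_flip:
  assumes "\<gamma> > 0" shows "distr (mu_beta \<gamma>) borel (\<lambda>a. 1 - a) = mu_beta \<gamma>"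
proof (rule measure_eqI)
  fix A assume A: "A \<in> sets (distr (mu_beta \<gamma>) borel (\<lambda>a. 1 - a))"
  then have [measurable]: "A \<in> sets borel" by simp
  show "emeasure (distr (mu_beta \<gamma>) borel (\<lambda>a. 1 - a)) A = emeasure (mu_beta \<gamma>) A"
    using nn_integral_mu_beta_flip[OF assms, of "indicator A"]
    by (simp add: nn_integral_distr flip: nn_integral_indicator)
qed simp

text \<open>The convolution of \<open>gamma_weight \<gamma>\<close> with itself, that is, the weight
  carried by the total of two sites.\<close>

definition pair_weight :: "real \<Rightarrow> real \<Rightarrow> ennreal" where
  "pair_weight \<gamma> t = (if 0 < t then ennreal (t powr (2 * \<gamma> - 1) * Beta \<gamma> \<gamma>) else 0)"

lemma pair_weight_measurable [measurable]: "pair_weight \<gamma> \<in> borel_measurable borel"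
  unfolding pair_weight_def by measurable

text \<open>Independence of total and fraction for Gamma variables: the substitution
  \<open>u = t * a\<close> and the homogeneity of the weights separate \<open>t\<close> from
  \<open>a\<close>. The exponent is \<open>2 * (\<gamma> - 1)\<close> from the two weights plus 1
  from the Jacobian.\<close>

lemma nn_integral_gamma_weight_pair:
  assumes "\<gamma> > 0" and [measurable]: "\<phi> \<in> borel_measurable borel"
  shows "(\<integral>\<^sup>+ u. ennreal (gamma_weight \<gamma> u * gamma_weight \<gamma> (t - u)) * \<phi> u \<partial>lborel) =
    pair_weight \<gamma> t * (\<integral>\<^sup>+ a. \<phi> (t * a) \<partial>mu_beta \<gamma>)"
proof (cases "t > 0")
  case True
  have sc: "gamma_weight \<gamma> (t * a) * gamma_weight \<gamma> (t - t * a) = t powr (\<gamma> - 1) * t powr (\<gamma> - 1) * (gamma_weight \<gamma> a * gamma_weight \<gamma> (1 - a))" for a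
    using gamma_weight_scale[OF True, of \<gamma> a] gamma_weight_scale[OF True, of \<gamma> "1 - a"]
    by (simp add: right_diff_distrib mult_ac)
  have pw: "t * (t powr (\<gamma> - 1) * t powr (\<gamma> - 1)) = t powr (2 * \<gamma> - 1)"
    using True by (simp add: powr_mult_base flip: powr_add)
  have "(\<integral>\<^sup>+ u. ennreal (gamma_weight \<gamma> u * gamma_weight \<gamma> (t - u)) * \<phi> u \<partial>lborel) =
    ennreal t * (\<integral>\<^sup>+ a. ennreal (gamma_weight \<gamma> (t * a) * gamma_weight \<gamma> (t - t * a)) * \<phi> (t * a) \<partial>lborel)"
    using True by (subst nn_integral_real_affine[where c = t and t = 0]) auto
  also have "\<dots> = ennreal t * (\<integral>\<^sup>+ a. ennreal (t powr (\<gamma> - 1) * t powr (\<gamma> - 1)) *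
        (ennreal (gamma_weight \<gamma> a * gamma_weight \<gamma> (1 - a)) * \<phi> (t * a)) \<partial>lborel)"
    unfolding sc by (simp add: ennreal_mult' mult.assoc)
  also have "\<dots> = ennreal (t powr (2 * \<gamma> - 1)) * 
       (\<integral>\<^sup>+ a. ennreal (gamma_weight \<gamma> a * gamma_weight \<gamma> (1 - a)) * \<phi> (t * a) \<partial>lborel)"
    using True pw by (subst nn_integral_cmult) (auto simp flip: mult.assoc ennreal_mult)
  also have "\<dots> = ennreal (t powr (2 * \<gamma> - 1)) * ((\<integral>\<^sup>+ a. \<phi> (t * a) \<partial>mu_beta \<gamma>) * ennreal (Beta \<gamma> \<gamma>))"
    using assms(1) by (subst nn_integral_mu_beta) auto
  finally show ?thesis 
    using True Beta_real_pos[OF assms(1) assms(1)]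
    by (simp add: pair_weight_def ennreal_mult mult.assoc mult.left_commute mult.commute[of "ennreal (Beta \<gamma> \<gamma>)"])
next
  case False
  then have "(\<lambda>u. ennreal (gamma_weight \<gamma> u * gamma_weight \<gamma> (t - u)) * \<phi> u) = (\<lambda>_. 0)"
    by (auto simp: gamma_weight_def fun_eq_iff)
  then have "(\<integral>\<^sup>+ u. ennreal (gamma_weight \<gamma> u * gamma_weight \<gamma> (t - u)) * \<phi> u \<partial>lborel) = 0"
    by simp
  then show ?thesis
    using False by (simp add: pair_weight_def)
qed

text \<open>At fixed total \<open>t\<close>, exchanging the two sites of a pair is the reflection of
  \<open>u\<close> to \<open>t - u\<close>, which permutes the two weights.\<close>

lemma nn_integral_gamma_weight_reflect:
  assumes [measurable]: "\<phi> \<in> borel_measurable borel"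
  shows "(\<integral>\<^sup>+ u. ennreal (gamma_weight \<gamma> u * gamma_weight \<gamma> (t - u)) * \<phi> (t - u) \<partial>lborel) =
    (\<integral>\<^sup>+ u. ennreal (gamma_weight \<gamma> u * gamma_weight \<gamma> (t - u)) * \<phi> u \<partial>lborel)"
  by (subst nn_integral_real_affine[where c = "-1" and t = t]) (auto simp: mult.commute)

subsection \<open>Integration over the simplex\<close>

lemma sets_nu_cond [simp, measurable_cong]: "sets (nu_cond \<gamma> \<E> N) = sets (cfg_space N)"
  by (simp add: nu_cond_def)

lemma space_nu_cond [simp]: "space (nu_cond \<gamma> \<E> N) = space (cfg_space N)"
  by (simp add: nu_cond_def)

lemma measurable_PiM_lborel_coord:
  "i \<in> I \<Longrightarrow> (\<lambda>x. x i) \<in> borel_measurable (PiM I (\<lambda>_. lborel :: real measure))"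
  using measurable_component_singleton[of i I "\<lambda>_. lborel :: real measure"] by simp

lemma measurable_cfg_space_coord [measurable]:
  "i < N \<Longrightarrow> (\<lambda>x. x i) \<in> borel_measurable (cfg_space N)"
  unfolding cfg_space_def by (simp add: measurable_PiM_lborel_coord)

lemma last_coord_measurable [measurable]:
  "last_coord \<E> N \<in> borel_measurable (PiM {..<N - 1} (\<lambda>_. lborel))"
  unfolding last_coord_def by (intro borel_measurable_diff borel_measurable_sum measurable_PiM_lborel_coord) auto

lemma measurable_into_cfg_space:
  assumes "\<And>k. k < N \<Longrightarrow> (\<lambda>x. f x k) \<in> borel_measurable M"
    and "\<And>x k. x \<in> space M \<Longrightarrow> \<not> k < N \<Longrightarrow> f x k = undefined"
  shows "f \<in> M \<rightarrow>\<^sub>M cfg_space N"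
  unfolding cfg_space_def
proof (rule measurable_PiM_single')
  fix k assume "k \<in> {..<N}"
  then show "(\<lambda>x. f x k) \<in> M \<rightarrow>\<^sub>M lborel"
    using assms(1) by simp
qed (use assms(2) in \<open>auto simp: PiE_iff extensional_def\<close>)

lemma complete_cfg_measurable [measurable]:
  "complete_cfg \<E> N \<in> PiM {..<N - 1} (\<lambda>_. lborel) \<rightarrow>\<^sub>M cfg_space N"
proof (rule measurable_into_cfg_space)
  fix k assume "k < N"
  show "(\<lambda>x. complete_cfg \<E> N x k) \<in> borel_measurable (Pi\<^sub>M {..<N - 1} (\<lambda>_. lborel))"
  proof (cases "k = N - 1")
    case True
    then show ?thesis
      using \<open>k < N\<close> last_coord_measurable[of \<E> N] by (simp add: complete_cfg_def)
  next
    case False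
    then have "k \<in> {..<N - 1}"
      using \<open>k < N\<close> by auto
    then show ?thesis
      using \<open>k < N\<close> False by (simp add: complete_cfg_def measurable_PiM_lborel_coord)
  qed
qed (simp add: complete_cfg_def)

lemma simplex_dens_measurable [measurable]:
  "simplex_dens \<gamma> \<E> N \<in> borel_measurable (PiM {..<N - 1} (\<lambda>_. lborel))"
  unfolding simplex_dens_eq_gamma_weight
  by (intro borel_measurable_times borel_measurable_prod measurable_compose[OF _ gamma_weight_measurable]
        measurable_PiM_lborel_coord last_coord_measurable) auto

lemmas [measurable] = complete_cfg_measurable[unfolded One_nat_def]
  simplex_dens_measurable[unfolded One_nat_def]

text \<open>The unnormalised integral. Invariance statements are proved for it, which keeps the
  normalising constant out of the Fubini arguments.\<close>

definition simplex_nn :: "real \<Rightarrow> real \<Rightarrow> nat \<Rightarrow> ((nat \<Rightarrow> real) \<Rightarrow> ennreal) \<Rightarrow> ennreal" where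
  "simplex_nn \<gamma> \<E> N F =
     (\<integral>\<^sup>+ y. ennreal (simplex_dens \<gamma> \<E> N y) * F (complete_cfg \<E> N y) \<partial>PiM {..<N - 1} (\<lambda>_. lborel))"

text \<open>Division in \<open>ennreal\<close> is multiplication by the inverse, and this constant
  leaves the integral; the identity is formal and holds whatever the total mass is.\<close>

lemma nn_integral_nu_cond:
  assumes [measurable]: "F \<in> borel_measurable (cfg_space N)"
  shows "(\<integral>\<^sup>+ x. F x \<partial>nu_cond \<gamma> \<E> N) = simplex_nn \<gamma> \<E> N F / simplex_nn \<gamma> \<E> N (\<lambda>_. 1)"
proof -
  have "(\<integral>\<^sup>+ x. F x \<partial>nu_cond \<gamma> \<E> N) =
    (\<integral>\<^sup>+ y. ennreal (simplex_dens \<gamma> \<E> N y) * inverse (simplex_nn \<gamma> \<E> N (\<lambda>_. 1)) *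
        F (complete_cfg \<E> N y) \<partial>PiM {..<N - 1} (\<lambda>_. lborel))"
    unfolding nu_cond_def simplex_nn_def divide_ennreal_def mult_1_right
    by (subst nn_integral_distr, measurable) (subst nn_integral_density; (measurable | rule refl))
  also have "\<dots> = (\<integral>\<^sup>+ y. ennreal (simplex_dens \<gamma> \<E> N y) * F (complete_cfg \<E> N y) *
        inverse (simplex_nn \<gamma> \<E> N (\<lambda>_. 1)) \<partial>PiM {..<N - 1} (\<lambda>_. lborel))"
    by (simp add: mult_ac)
  also have "\<dots> = simplex_nn \<gamma> \<E> N F / simplex_nn \<gamma> \<E> N (\<lambda>_. 1)"
    unfolding divide_ennreal_def by (subst nn_integral_multc) (simp_all add: simplex_nn_def)
  finally show ?thesis .
qed

interpretation lborel_product: product_sigma_finite "\<lambda>_::nat. lborel :: real measure"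
  by standard

lemma prod_fun_upd_other:
  "i \<notin> I \<Longrightarrow> (\<Prod>k\<in>I. g ((x(i := u)) k)) = (\<Prod>k\<in>I. g (x k))"
  by (intro prod.cong) auto

lemma sum_fun_upd_other:
  "i \<notin> I \<Longrightarrow> (\<Sum>k\<in>I. (x(i := u)) k) = (\<Sum>k\<in>I. x k)"
  by (intro sum.cong) auto

lemma measurable_fun_upd_lborel:
  assumes "i < n"
  shows "(\<lambda>(x, u). x(i := u)) \<in> PiM ({..<n} - {i}) (\<lambda>_. lborel) \<Otimes>\<^sub>M lborel \<rightarrow>\<^sub>M PiM {..<n} (\<lambda>_. lborel :: real measure)"
proof -
  have "insert i ({..<n} - {i}) = {..<n}"
    using assms by auto
  then show ?thesis
    using measurable_add_dim[of i "{..<n} - {i}" "\<lambda>_. lborel :: real measure"] by simp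
qed

text \<open>Fubini with coordinate \<open>i\<close> innermost. With the other free coordinates
  frozen, site \<open>i\<close> and the last site share the remaining mass, and the inner integrand
  carries exactly the pair weight treated above.\<close>

lemma simplex_nn_split:
  fixes \<gamma> \<E> :: real
  assumes i: "i < N - 1" and [measurable]: "F \<in> borel_measurable (cfg_space N)"
  defines "I \<equiv> {..<N - 1} - {i}"
  shows "simplex_nn \<gamma> \<E> N F =
    (\<integral>\<^sup>+ x. ennreal (\<Prod>k\<in>I. gamma_weight \<gamma> (x k)) *
       (\<integral>\<^sup>+ u. ennreal (gamma_weight \<gamma> u * gamma_weight \<gamma> (N * \<E> - (\<Sum>k\<in>I. x k) - u)) * F (complete_cfg \<E> N (x(i := u))) \<partial>lborel)
     \<partial>PiM I (\<lambda>_. lborel))"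
proof -
  have ins: "{..<N - 1} = insert i I" and fin: "finite I" and nin: "i \<notin> I"
    using i by (auto simp: I_def)
  note [measurable] = measurable_fun_upd_lborel[OF i, folded I_def]
  have dens: "simplex_dens \<gamma> \<E> N (x(i := u)) = (\<Prod>k\<in>I. gamma_weight \<gamma> (x k)) * 
     (gamma_weight \<gamma> u * gamma_weight \<gamma> (N * \<E> - (\<Sum>k\<in>I. x k) - u))" for x u
    unfolding simplex_dens_eq_gamma_weight last_coord_def ins using fin nin
    by (simp add: prod_fun_upd_other sum_fun_upd_other algebra_simps del: fun_upd_apply) (simp add: add.commute)
  have "simplex_nn \<gamma> \<E> N F =
    (\<integral>\<^sup>+ x. \<integral>\<^sup>+ u. ennreal (simplex_dens \<gamma> \<E> N (x(i := u))) * F (complete_cfg \<E> N (x(i := u))) \<partial>lborel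
     \<partial>PiM I (\<lambda>_. lborel))"
    unfolding simplex_nn_def ins
    by (rule lborel_product.product_nn_integral_insert[OF fin nin]) (use ins in \<open>simp flip: ins\<close>)
  also have "\<dots> = (\<integral>\<^sup>+ x. ennreal (\<Prod>k\<in>I. gamma_weight \<gamma> (x k)) *
       (\<integral>\<^sup>+ u. ennreal (gamma_weight \<gamma> u * gamma_weight \<gamma> (N * \<E> - (\<Sum>k\<in>I. x k) - u)) * F (complete_cfg \<E> N (x(i := u))) \<partial>lborel)
     \<partial>PiM I (\<lambda>_. lborel))"
  proof (rule nn_integral_cong)
    fix x assume x: "x \<in> space (PiM I (\<lambda>_. lborel :: real measure))"
    have [measurable]: "(\<lambda>u. x(i := u)) \<in> lborel \<rightarrow>\<^sub>M PiM {..<N - 1} (\<lambda>_. lborel)"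
      using measurable_compose[OF measurable_Pair1'[OF x] measurable_fun_upd_lborel[OF i, folded I_def]]
      by (simp add: comp_def)
    show "(\<integral>\<^sup>+ u. ennreal (simplex_dens \<gamma> \<E> N (x(i := u))) * F (complete_cfg \<E> N (x(i := u))) \<partial>lborel)
      = ennreal (\<Prod>k\<in>I. gamma_weight \<gamma> (x k)) *
       (\<integral>\<^sup>+ u. ennreal (gamma_weight \<gamma> u * gamma_weight \<gamma> (N * \<E> - (\<Sum>k\<in>I. x k) - u)) * F (complete_cfg \<E> N (x(i := u))) \<partial>lborel)"
      unfolding dens
      by (subst nn_integral_cmult[symmetric])
         (auto simp: ennreal_mult' prod_nonneg mult.assoc intro!: nn_integral_cong)
  qed
  finally show ?thesis .
qed

lemma complete_cfg_apply:
  "complete_cfg \<E> N y k = (if k < N then if k = N - 1 then last_coord \<E> N y else y k else undefined)"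
  by (simp add: complete_cfg_def)

lemma T_op_measurable [measurable]:
  assumes "i < N" "j < N"
  shows "(\<lambda>(x, a). T_op i j a x) \<in> cfg_space N \<Otimes>\<^sub>M borel \<rightarrow>\<^sub>M cfg_space N"
proof (rule measurable_into_cfg_space)
  fix k assume k: "k < N"
  note [measurable] = measurable_cfg_space_coord[OF assms(1)] measurable_cfg_space_coord[OF assms(2)]
     measurable_cfg_space_coord[OF k]
  show "(\<lambda>x. (case x of (x, a) \<Rightarrow> T_op i j a x) k) \<in> borel_measurable (cfg_space N \<Otimes>\<^sub>M borel)"
    unfolding T_op_def case_prod_unfold fun_upd_apply by measurable
qed (use assms in \<open>auto simp: T_op_def space_pair_measure cfg_space_def space_PiM PiE_iff extensional_def\<close>)

lemma T_op_measurable_param: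
  assumes "i < N" "j < N" "x \<in> space (cfg_space N)"
  shows "(\<lambda>a. T_op i j a x) \<in> borel \<rightarrow>\<^sub>M cfg_space N"
  using measurable_compose[OF measurable_Pair1'[OF assms(3)] T_op_measurable[OF assms(1,2)]] by simp

lemma sigma_finite_mu_beta: "\<gamma> > 0 \<Longrightarrow> sigma_finite_measure (mu_beta \<gamma>)"
  using prob_space_mu_beta prob_space_imp_sigma_finite by blast

lemma nn_integral_T_op_measurable:
  assumes "\<gamma> > 0" "i < N" "j < N" and [measurable]: "F \<in> borel_measurable (cfg_space N)"
  shows "(\<lambda>x. \<integral>\<^sup>+ a. F (T_op i j a x) \<partial>mu_beta \<gamma>) \<in> borel_measurable (cfg_space N)"
proof -
  interpret sigma_finite_measure "mu_beta \<gamma>"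
    by (rule sigma_finite_mu_beta) fact
  have "(\<lambda>(x, a). F (T_op i j a x)) \<in> borel_measurable (cfg_space N \<Otimes>\<^sub>M mu_beta \<gamma>)"
    using measurable_compose[OF T_op_measurable[OF assms(2,3)] assms(4)] by (simp add: case_prod_unfold cong: measurable_cong_sets)
  then show ?thesis
    by (rule borel_measurable_nn_integral)
qed

lemma measurable_fun_upd_slice:
  assumes "i < n" "x \<in> space (PiM ({..<n} - {i}) (\<lambda>_. lborel :: real measure))"
  shows "(\<lambda>u. x(i := u)) \<in> borel \<rightarrow>\<^sub>M PiM {..<n} (\<lambda>_. lborel :: real measure)"
  using measurable_compose[OF measurable_Pair1'[OF assms(2)] measurable_fun_upd_lborel[OF assms(1)]]
  by (simp cong: measurable_cong_sets)

lemma last_coord_fun_upd: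
  assumes "i < N - 1"
  shows "last_coord \<E> N (x(i := u)) = N * \<E> - (\<Sum>k\<in>{..<N - 1} - {i}. x k) - u"
proof -
  have "(\<Sum>k<N - 1. (x(i := u)) k) = u + (\<Sum>k\<in>{..<N - 1} - {i}. (x(i := u)) k)"
    using assms by (subst sum.remove[of _ i]) auto
  then show ?thesis
    by (simp add: last_coord_def sum_fun_upd_other del: fun_upd_apply)
qed

text \<open>With the other sites frozen and \<open>?t\<close> the total of the pair, the resampled
  configuration depends on the fraction \<open>a\<close> alone and the old value \<open>u\<close>
  drops out. By \<open>nn_integral_gamma_weight_pair\<close> both inner integrals become
  \<open>pair_weight\<close> at \<open>?t\<close> times the same Beta average.\<close>

lemma simplex_nn_resample_last:
  assumes g: "\<gamma> > 0" and i: "i < N - 1" and [measurable]: "F \<in> borel_measurable (cfg_space N)"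
  shows "simplex_nn \<gamma> \<E> N (\<lambda>x. \<integral>\<^sup>+ a. F (T_op i (N - 1) a x) \<partial>mu_beta \<gamma>) = simplex_nn \<gamma> \<E> N F"
proof -
  interpret mu: prob_space "mu_beta \<gamma>"
    by (rule prob_space_mu_beta) fact
  have iN: "i < N" "N - 1 < N" "i \<noteq> N - 1"
    using i by auto
  show ?thesis
    unfolding simplex_nn_split[OF i nn_integral_T_op_measurable[OF g iN(1,2) assms(3)]] simplex_nn_split[OF i assms(3)]
  proof (rule nn_integral_cong, rule arg_cong2[where f = "(*)", OF refl])
    fix x assume x: "x \<in> space (PiM ({..<N - 1} - {i}) (\<lambda>_. lborel :: real measure))"
    note [measurable] = measurable_fun_upd_slice[OF i x]
    let ?t = "N * \<E> - (\<Sum>k\<in>{..<N - 1} - {i}. x k)"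
    have lc: "last_coord \<E> N (x(i := u)) = ?t - u" for u
      by (rule last_coord_fun_upd[OF i])
    have T: "T_op i (N - 1) a (complete_cfg \<E> N (x(i := u))) = complete_cfg \<E> N (x(i := ?t * a))" for a u
      using iN i
      by (auto simp: fun_eq_iff lc T_op_def complete_cfg_apply algebra_simps)
    show "(\<integral>\<^sup>+ u. ennreal (gamma_weight \<gamma> u * gamma_weight \<gamma> (?t - u)) * 
        (\<integral>\<^sup>+ a. F (T_op i (N - 1) a (complete_cfg \<E> N (x(i := u)))) \<partial>mu_beta \<gamma>) \<partial>lborel) =
      (\<integral>\<^sup>+ u. ennreal (gamma_weight \<gamma> u * gamma_weight \<gamma> (?t - u)) * F (complete_cfg \<E> N (x(i := u))) \<partial>lborel)"
      unfolding T 
      by (subst (1 2) nn_integral_gamma_weight_pair[OF g]) (simp_all add: mu.emeasure_space_1[simplified])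
  qed
qed

section \<open>Exchanging a site with the last one\<close>

abbreviation swap_last :: "nat \<Rightarrow> nat \<Rightarrow> nat \<Rightarrow> nat" where
  "swap_last N b \<equiv> Transposition.transpose b (N - 1)"

lemma swap_last_measurable:
  assumes "b < N - 1"
  shows "(\<lambda>x. x \<circ> swap_last N b) \<in> cfg_space N \<rightarrow>\<^sub>M cfg_space N"
proof (rule measurable_into_cfg_space)
  fix k assume "k < N"
  then show "(\<lambda>x. (x \<circ> swap_last N b) k) \<in> borel_measurable (cfg_space N)"
    using assms by (auto intro!: measurable_cfg_space_coord simp: Transposition.transpose_def)
qed (use assms in \<open>auto simp: Transposition.transpose_def cfg_space_def space_PiM PiE_iff extensional_def\<close>)

text \<open>The last coordinate is computed from the others, so its symmetry with them is not
  visible in the density. After \<open>simplex_nn_split\<close> the exchange is the reflection of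
  \<open>u\<close> inside the pair total.\<close>

lemma simplex_nn_swap_last:
  assumes i: "i < N - 1" and [measurable]: "F \<in> borel_measurable (cfg_space N)"
  shows "simplex_nn \<gamma> \<E> N (\<lambda>x. F (x \<circ> swap_last N i)) = simplex_nn \<gamma> \<E> N F"
proof -
  have iN: "i < N" "N - 1 < N" "i \<noteq> N - 1"
    using i by auto
  have F: "(\<lambda>x. F (x \<circ> swap_last N i)) \<in> borel_measurable (cfg_space N)"
    using measurable_compose[OF swap_last_measurable[OF i] assms(2)] .
  show ?thesis
    unfolding simplex_nn_split[OF i F] simplex_nn_split[OF i assms(2)]
  proof (rule nn_integral_cong, rule arg_cong2[where f = "(*)", OF refl])
    fix x assume x: "x \<in> space (PiM ({..<N - 1} - {i}) (\<lambda>_. lborel :: real measure))"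
    note [measurable] = measurable_fun_upd_slice[OF i x]
    let ?t = "N * \<E> - (\<Sum>k\<in>{..<N - 1} - {i}. x k)"
    have lc: "last_coord \<E> N (x(i := u)) = ?t - u" for u
      by (rule last_coord_fun_upd[OF i])
    have T: "complete_cfg \<E> N (x(i := u)) \<circ> swap_last N i = complete_cfg \<E> N (x(i := ?t - u))" for u
      using iN i
      by (auto simp: fun_eq_iff lc complete_cfg_apply Transposition.transpose_def algebra_simps)
    show "(\<integral>\<^sup>+ u. ennreal (gamma_weight \<gamma> u * gamma_weight \<gamma> (?t - u)) * 
        F (complete_cfg \<E> N (x(i := u)) \<circ> swap_last N i) \<partial>lborel) =
      (\<integral>\<^sup>+ u. ennreal (gamma_weight \<gamma> u * gamma_weight \<gamma> (?t - u)) * F (complete_cfg \<E> N (x(i := u))) \<partial>lborel)"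
      unfolding T by (rule nn_integral_gamma_weight_reflect) measurable
  qed
qed

section \<open>Integrals over three sites with a given total\<close>

definition triple_nn :: "real \<Rightarrow> real \<Rightarrow> (real \<Rightarrow> real \<Rightarrow> ennreal) \<Rightarrow> ennreal" where
  "triple_nn \<gamma> t \<phi> =
     (\<integral>\<^sup>+ u. \<integral>\<^sup>+ v. ennreal (gamma_weight \<gamma> u * (gamma_weight \<gamma> v * gamma_weight \<gamma> (t - u - v))) * \<phi> u v \<partial>lborel \<partial>lborel)"

text \<open>Both variables are scaled by \<open>t\<close>: three weights give
  \<open>3 * (\<gamma> - 1)\<close> and two Jacobians give 2, hence the exponent
  \<open>3 * \<gamma> - 1\<close>.\<close>

lemma triple_nn_scale:
  assumes t: "t > 0" and [measurable]: "case_prod \<phi> \<in> borel_measurable (borel \<Otimes>\<^sub>M borel)"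
  shows "triple_nn \<gamma> t \<phi> = ennreal (t powr (3 * \<gamma> - 1)) * triple_nn \<gamma> 1 (\<lambda>u v. \<phi> (t * u) (t * v))"
proof -
  define c where "c = t powr (\<gamma> - 1) * (t powr (\<gamma> - 1) * t powr (\<gamma> - 1))"
  have c: "c \<ge> 0" "t * (t * c) = t powr (3 * \<gamma> - 1)"
    using t by (auto simp: c_def powr_mult_base simp flip: powr_add)
  have sc: "gamma_weight \<gamma> (t * u) * (gamma_weight \<gamma> (t * v) * gamma_weight \<gamma> (t - t * u - t * v)) = 
     c * (gamma_weight \<gamma> u * (gamma_weight \<gamma> v * gamma_weight \<gamma> (1 - u - v)))" for u v
    using gamma_weight_scale[OF t, of \<gamma> u] gamma_weight_scale[OF t, of \<gamma> v] gamma_weight_scale[OF t, of \<gamma> "1 - u - v"]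
    by (simp add: right_diff_distrib mult_ac c_def)
  have "triple_nn \<gamma> t \<phi> = ennreal t * (\<integral>\<^sup>+ u. \<integral>\<^sup>+ v. 
      ennreal (gamma_weight \<gamma> (t * u) * (gamma_weight \<gamma> v * gamma_weight \<gamma> (t - t * u - v))) * \<phi> (t * u) v \<partial>lborel \<partial>lborel)"
    unfolding triple_nn_def using t
    by (subst nn_integral_real_affine[where c = t and t = 0]) auto
  also have "\<dots> = ennreal t * (\<integral>\<^sup>+ u. ennreal t * (\<integral>\<^sup>+ v. 
      ennreal (gamma_weight \<gamma> (t * u) * (gamma_weight \<gamma> (t * v) * gamma_weight \<gamma> (t - t * u - t * v))) * \<phi> (t * u) (t * v) \<partial>lborel) \<partial>lborel)"
    using t
    by (subst nn_integral_real_affine[where c = t and t = 0 and f = "\<lambda>v. ennreal (gamma_weight \<gamma> (t * u) * (gamma_weight \<gamma> v * gamma_weight \<gamma> (t - t * u - v))) * \<phi> (t * u) v" for u]) auto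
  also have "\<dots> = ennreal t * (\<integral>\<^sup>+ u. ennreal t * (\<integral>\<^sup>+ v. 
      ennreal c * (ennreal (gamma_weight \<gamma> u * (gamma_weight \<gamma> v * gamma_weight \<gamma> (1 - u - v))) * \<phi> (t * u) (t * v)) \<partial>lborel) \<partial>lborel)"
    unfolding sc using c by (simp add: ennreal_mult' mult.assoc)
  also have "\<dots> = ennreal t * (ennreal t * (ennreal c * triple_nn \<gamma> 1 (\<lambda>u v. \<phi> (t * u) (t * v))))"
    unfolding triple_nn_def by (simp add: nn_integral_cmult)
  also have "\<dots> = ennreal (t powr (3 * \<gamma> - 1)) * triple_nn \<gamma> 1 (\<lambda>u v. \<phi> (t * u) (t * v))"
    using t c by (simp flip: mult.assoc ennreal_mult)
  finally show ?thesis .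
qed

lemma triple_nn_nonpos:
  assumes "t \<le> 0" shows "triple_nn \<gamma> t \<phi> = 0"
proof -
  have "(\<lambda>u v. ennreal (gamma_weight \<gamma> u * (gamma_weight \<gamma> v * gamma_weight \<gamma> (t - u - v))) * \<phi> u v) = (\<lambda>_ _. 0)"
    using assms by (auto simp: gamma_weight_def fun_eq_iff)
  then show ?thesis
    unfolding triple_nn_def by (simp only: fun_eq_iff) simp
qed

text \<open>Integrating out \<open>v\<close> first merges two sites into one of parameter
  \<open>2 * \<gamma>\<close>, and what remains is a Beta integral with parameters
  \<open>\<gamma>\<close> and \<open>2 * \<gamma>\<close>.\<close>

lemma triple_nn_total:
  assumes g: "\<gamma> > 0"
  shows "triple_nn \<gamma> 1 (\<lambda>_ _. 1) = ennreal (Beta \<gamma> (2 * \<gamma>) * Beta \<gamma> \<gamma>)"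
proof -
  interpret mu: prob_space "mu_beta \<gamma>"
    by (rule prob_space_mu_beta) fact
  have p: "pair_weight \<gamma> (1 - u) = ennreal (gamma_weight (2 * \<gamma>) (1 - u) * Beta \<gamma> \<gamma>)" for u
    by (simp add: pair_weight_def gamma_weight_def)
  have "triple_nn \<gamma> 1 (\<lambda>_ _. 1) =
    (\<integral>\<^sup>+ u. ennreal (gamma_weight \<gamma> u) * (\<integral>\<^sup>+ v. ennreal (gamma_weight \<gamma> v * gamma_weight \<gamma> (1 - u - v)) * 1 \<partial>lborel) \<partial>lborel)"
    unfolding triple_nn_def 
    by (subst nn_integral_cmult[symmetric]) (auto simp: ennreal_mult' intro!: nn_integral_cong)
  also have "\<dots> = (\<integral>\<^sup>+ u. ennreal (gamma_weight \<gamma> u) * pair_weight \<gamma> (1 - u) \<partial>lborel)"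
    by (subst nn_integral_gamma_weight_pair[OF g]) (simp_all add: mu.emeasure_space_1[simplified])
  also have "\<dots> = (\<integral>\<^sup>+ u. ennreal (gamma_weight \<gamma> u * gamma_weight (2 * \<gamma>) (1 - u)) * ennreal (Beta \<gamma> \<gamma>) \<partial>lborel)"
    using Beta_real_pos[OF g g] by (simp add: p ennreal_mult' ennreal_mult'' mult.assoc)
  also have "\<dots> = ennreal (Beta \<gamma> (2 * \<gamma>) * Beta \<gamma> \<gamma>)"
    using g Beta_real_pos[OF g g] nn_integral_gamma_weight_Beta[OF g, of "2 * \<gamma>"]
    by (simp add: nn_integral_multc) (simp add: ennreal_mult'')
  finally show ?thesis .
qed

lemma simplex_nn_split2:
  fixes \<gamma> \<E> :: real
  assumes ij: "i < N - 1" "j < N - 1" "i \<noteq> j" and F: "F \<in> borel_measurable (cfg_space N)"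
  defines "J \<equiv> {..<N - 1} - {i} - {j}"
  shows "simplex_nn \<gamma> \<E> N F =
    (\<integral>\<^sup>+ x. ennreal (\<Prod>k\<in>J. gamma_weight \<gamma> (x k)) *
       triple_nn \<gamma> (N * \<E> - (\<Sum>k\<in>J. x k)) (\<lambda>u v. F (complete_cfg \<E> N (x(i := u, j := v))))
     \<partial>PiM J (\<lambda>_. lborel))"
proof -
  define I where "I = {..<N - 1} - {j}"
  have I: "I = insert i J" and fin: "finite J" and nin: "i \<notin> J" "j \<notin> J"
    using ij by (auto simp: J_def I_def)
  define t where "t x = N * \<E> - (\<Sum>k\<in>J. x k)" for x :: "nat \<Rightarrow> real"
  note [measurable] = F
  have upd_j [measurable]: "(\<lambda>(x, v). x(j := v)) \<in> PiM I (\<lambda>_. lborel) \<Otimes>\<^sub>M lborel \<rightarrow>\<^sub>M PiM {..<N - 1} (\<lambda>_. lborel :: real measure)"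
    using measurable_fun_upd_lborel[OF ij(2), folded I_def] .
  note [measurable] = upd_j[unfolded One_nat_def]
  have upd_i [measurable]: "(\<lambda>(x, u). x(i := u)) \<in> PiM J (\<lambda>_. lborel) \<Otimes>\<^sub>M lborel \<rightarrow>\<^sub>M PiM I (\<lambda>_. lborel :: real measure)"
    using measurable_add_dim[of i J "\<lambda>_. lborel :: real measure"] by (simp add: I)
  have meas_prod [measurable]: "(\<lambda>x. \<Prod>k\<in>I. gamma_weight \<gamma> (x k)) \<in> borel_measurable (PiM I (\<lambda>_. lborel :: real measure))"
    by (intro borel_measurable_prod measurable_compose[OF _ gamma_weight_measurable] measurable_PiM_lborel_coord)
  have meas_sum [measurable]: "(\<lambda>x. \<Sum>k\<in>I. x k) \<in> borel_measurable (PiM I (\<lambda>_. lborel :: real measure))"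
    by (intro borel_measurable_sum measurable_PiM_lborel_coord)
  define G where "G x = ennreal (\<Prod>k\<in>I. gamma_weight \<gamma> (x k)) *
       (\<integral>\<^sup>+ v. ennreal (gamma_weight \<gamma> v * gamma_weight \<gamma> (N * \<E> - (\<Sum>k\<in>I. x k) - v)) * F (complete_cfg \<E> N (x(j := v))) \<partial>lborel)" for x
  have G [measurable]: "G \<in> borel_measurable (PiM I (\<lambda>_. lborel :: real measure))"
    unfolding G_def by measurable
  have prd: "(\<Prod>k\<in>I. gamma_weight \<gamma> ((x(i := u)) k)) = gamma_weight \<gamma> u * (\<Prod>k\<in>J. gamma_weight \<gamma> (x k))" for x u
    unfolding I using fin nin by (simp add: prod_fun_upd_other del: fun_upd_apply) simp
  have sm: "N * \<E> - (\<Sum>k\<in>I. (x(i := u)) k) = t x - u" for x u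
    unfolding I t_def using fin nin by (simp add: sum_fun_upd_other del: fun_upd_apply) simp
  have "simplex_nn \<gamma> \<E> N F = (\<integral>\<^sup>+ x. G x \<partial>PiM I (\<lambda>_. lborel))"
    unfolding G_def simplex_nn_split[OF ij(2) F] I_def ..
  also have "\<dots> = (\<integral>\<^sup>+ x. \<integral>\<^sup>+ u. G (x(i := u)) \<partial>lborel \<partial>PiM J (\<lambda>_. lborel))"
    unfolding I by (rule lborel_product.product_nn_integral_insert[OF fin nin(1)]) (use G in \<open>simp add: I\<close>)
  also have "\<dots> = (\<integral>\<^sup>+ x. ennreal (\<Prod>k\<in>J. gamma_weight \<gamma> (x k)) *
       triple_nn \<gamma> (t x) (\<lambda>u v. F (complete_cfg \<E> N (x(i := u, j := v)))) \<partial>PiM J (\<lambda>_. lborel))"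
  proof (rule nn_integral_cong)
    fix x assume x: "x \<in> space (PiM J (\<lambda>_. lborel :: real measure))"
    have upd_x [measurable]: "(\<lambda>u. x(i := u)) \<in> borel \<rightarrow>\<^sub>M PiM I (\<lambda>_. lborel :: real measure)"
      using measurable_compose[OF measurable_Pair1'[OF x] upd_i] by (simp cong: measurable_cong_sets)
    have upd_xx: "(\<lambda>(u, v). x(i := u, j := v)) \<in> borel \<Otimes>\<^sub>M borel \<rightarrow>\<^sub>M PiM {..<N - 1} (\<lambda>_. lborel :: real measure)"
    proof -
      have "(\<lambda>(u, v). (x(i := u), v)) \<in> borel \<Otimes>\<^sub>M borel \<rightarrow>\<^sub>M PiM I (\<lambda>_. lborel :: real measure) \<Otimes>\<^sub>M lborel"
        by measurable
      from measurable_compose[OF this upd_j] show ?thesis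
        by (simp add: case_prod_unfold)
    qed
    have [measurable]: "(\<lambda>(u, v). F (complete_cfg \<E> N (x(i := u, j := v)))) \<in> borel_measurable (borel \<Otimes>\<^sub>M borel)"
      using measurable_compose[OF measurable_compose[OF upd_xx complete_cfg_measurable] F] by (simp add: case_prod_unfold)
    have "(\<integral>\<^sup>+ u. G (x(i := u)) \<partial>lborel) = (\<integral>\<^sup>+ u. ennreal (\<Prod>k\<in>J. gamma_weight \<gamma> (x k)) *
        (\<integral>\<^sup>+ v. ennreal (gamma_weight \<gamma> u * (gamma_weight \<gamma> v * gamma_weight \<gamma> (t x - u - v))) * F (complete_cfg \<E> N (x(i := u, j := v))) \<partial>lborel) \<partial>lborel)"
    proof (rule nn_integral_cong)
      fix u
      show "G (x(i := u)) = ennreal (\<Prod>k\<in>J. gamma_weight \<gamma> (x k)) *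
        (\<integral>\<^sup>+ v. ennreal (gamma_weight \<gamma> u * (gamma_weight \<gamma> v * gamma_weight \<gamma> (t x - u - v))) * F (complete_cfg \<E> N (x(i := u, j := v))) \<partial>lborel)"
        unfolding G_def prd sm
        by (simp add: ennreal_mult' prod_nonneg mult.assoc flip: nn_integral_cmult)
           (simp add: mult_ac)
    qed
    also have "\<dots> = ennreal (\<Prod>k\<in>J. gamma_weight \<gamma> (x k)) *
       triple_nn \<gamma> (t x) (\<lambda>u v. F (complete_cfg \<E> N (x(i := u, j := v))))"
      unfolding triple_nn_def by (simp add: nn_integral_cmult)
    finally show "(\<integral>\<^sup>+ u. G (x(i := u)) \<partial>lborel) = ennreal (\<Prod>k\<in>J. gamma_weight \<gamma> (x k)) *
       triple_nn \<gamma> (t x) (\<lambda>u v. F (complete_cfg \<E> N (x(i := u, j := v))))" .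
  qed
  finally show ?thesis
    unfolding t_def .
qed

subsection \<open>Resampling pairs and triples\<close>

text \<open>The three-site analogue of \<open>T_op\<close>. The mean \<open>1 / 3\<close> used for
  \<open>y\<close> corresponds to total mass 1, so the coordinates of \<open>y\<close> are the
  fractions of the mass of the triple.\<close>

definition S_op :: "nat \<Rightarrow> nat \<Rightarrow> nat \<Rightarrow> (nat \<Rightarrow> real) \<Rightarrow> (nat \<Rightarrow> real) \<Rightarrow> (nat \<Rightarrow> real)" where
  "S_op i j k y x = x(i := (x i + x j + x k) * y 0, j := (x i + x j + x k) * y 1, k := (x i + x j + x k) * y 2)"

lemma S_op_measurable [measurable]:
  assumes "i < N" "j < N" "k < N"
  shows "(\<lambda>(x, y). S_op i j k y x) \<in> cfg_space N \<Otimes>\<^sub>M cfg_space 3 \<rightarrow>\<^sub>M cfg_space N"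
proof (rule measurable_into_cfg_space)
  fix l assume l: "l < N"
  have c: "(\<lambda>z. fst z q) \<in> borel_measurable (cfg_space N \<Otimes>\<^sub>M cfg_space 3)" if "q < N" for q
    using measurable_compose[OF measurable_fst measurable_cfg_space_coord[OF that]] .
  have d: "(\<lambda>z. snd z q) \<in> borel_measurable (cfg_space N \<Otimes>\<^sub>M cfg_space 3)" if "q < 3" for q
    using measurable_compose[OF measurable_snd measurable_cfg_space_coord[OF that]] .
  have "(\<lambda>z. (fst z i + fst z j + fst z k) * snd z q) \<in> borel_measurable (cfg_space N \<Otimes>\<^sub>M cfg_space 3)" if "q < 3" for q
    by (intro borel_measurable_times borel_measurable_add c d assms that)
  from this[of 0] this[of 1] this[of 2] c[OF l]
  show "(\<lambda>x. (case x of (x, y) \<Rightarrow> S_op i j k y x) l) \<in> borel_measurable (cfg_space N \<Otimes>\<^sub>M cfg_space 3)"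
    by (cases "l = k"; cases "l = j"; cases "l = i") (simp_all add: S_op_def case_prod_unfold)
qed (use assms in \<open>auto simp: S_op_def space_pair_measure cfg_space_def space_PiM PiE_iff extensional_def\<close>)

lemma S_op_measurable_param:
  assumes "i < N" "j < N" "k < N" "x \<in> space (cfg_space N)"
  shows "(\<lambda>y. S_op i j k y x) \<in> cfg_space 3 \<rightarrow>\<^sub>M cfg_space N"
  using measurable_compose[OF measurable_Pair1'[OF assms(4)] S_op_measurable[OF assms(1-3)]] by simp

text \<open>The base function is the only point of the empty product space, which is where
  \<open>simplex_nn_split2\<close> puts its frozen coordinates when there are three sites.\<close>

definition simplex_point :: "real \<Rightarrow> real \<Rightarrow> nat \<Rightarrow> real" where
  "simplex_point u v = complete_cfg (1 / 3) 3 ((\<lambda>_. undefined)(0 := u, Suc 0 := v))"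

lemma simplex_point_simps:
  "simplex_point u v 0 = u" "simplex_point u v (Suc 0) = v" "simplex_point u v 2 = 1 - u - v"
  by (simp_all add: simplex_point_def complete_cfg_apply last_coord_def numeral_2_eq_2)

lemma simplex_nn_3:
  assumes "F \<in> borel_measurable (cfg_space 3)"
  shows "simplex_nn \<gamma> (1 / 3) 3 F = triple_nn \<gamma> 1 (\<lambda>u v. F (simplex_point u v))"
proof -
  have e: "{..<3 - 1} - {0} - {Suc 0} = ({} :: nat set)"
    by auto
  show ?thesis
    using simplex_nn_split2[OF _ _ _ assms, of 0 "Suc 0" \<gamma> "1 / 3"]
    unfolding e by (simp add: PiM_empty nn_integral_count_space_finite simplex_point_def fun_upd_def)
qed

lemma triple_total_pos:
  "\<gamma> > 0 \<Longrightarrow> ennreal (Beta \<gamma> (2 * \<gamma>) * Beta \<gamma> \<gamma>) \<noteq> 0"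
  using Beta_real_pos[of \<gamma> "2 * \<gamma>"] Beta_real_pos[of \<gamma> \<gamma>] by (auto simp: ennreal_eq_0_iff not_le)

lemma nn_integral_nu_3:
  assumes "\<gamma> > 0" "F \<in> borel_measurable (cfg_space 3)"
  shows "(\<integral>\<^sup>+ y. F y \<partial>nu_cond \<gamma> (1 / 3) 3) * ennreal (Beta \<gamma> (2 * \<gamma>) * Beta \<gamma> \<gamma>) =
     triple_nn \<gamma> 1 (\<lambda>u v. F (simplex_point u v))"
proof -
  have "simplex_nn \<gamma> (1 / 3) 3 F / ennreal (Beta \<gamma> (2 * \<gamma>) * Beta \<gamma> \<gamma>) * ennreal (Beta \<gamma> (2 * \<gamma>) * Beta \<gamma> \<gamma>)
      = simplex_nn \<gamma> (1 / 3) 3 F"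
    using triple_total_pos[OF assms(1)]
    by (metis divide_mult_eq ennreal_neq_top ennreal_divide_times ennreal_times_divide mult_divide_eq_ennreal)
  then show ?thesis
    using assms by (simp only: nn_integral_nu_cond simplex_nn_3 triple_nn_total borel_measurable_const)
qed

text \<open>The three-site mass is a product of Beta values, hence neither zero nor infinite. A
  probability law is what allows a function of three sites to be centred and compared with
  \<open>kappa\<close>.\<close>

lemma prob_space_nu_3:
  assumes g: "\<gamma> > 0" shows "prob_space (nu_cond \<gamma> (1 / 3) 3)"
proof (rule prob_spaceI)
  have "(\<integral>\<^sup>+ y. 1 \<partial>nu_cond \<gamma> (1 / 3) 3) = 1"
    using triple_total_pos[OF g]
    by (simp only: nn_integral_nu_cond simplex_nn_3 triple_nn_total[OF g] borel_measurable_const)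
       (intro ennreal_divide_self, auto)
  then show "emeasure (nu_cond \<gamma> (1 / 3) 3) (space (nu_cond \<gamma> (1 / 3) 3)) = 1"
    by simp
qed

text \<open>Only the total \<open>t x\<close> of the triple survives and the old values
  \<open>u\<close>, \<open>v\<close> drop out. The third fraction \<open>1 - a - b\<close> agrees
  with the last coordinate forced by the total mass.\<close>

lemma S_op_complete_cfg:
  fixes \<E> :: real
  assumes ij: "i < N - 1" "j < N - 1" "i \<noteq> j"
  defines "t \<equiv> \<lambda>x. N * \<E> - (\<Sum>k\<in>{..<N - 1} - {i} - {j}. x k)"
  shows "S_op i j (N - 1) (simplex_point a b) (complete_cfg \<E> N (x(i := u, j := v))) =
      complete_cfg \<E> N (x(i := t x * a, j := t x * b))"
proof -
  have "{..<N - 1} - {j} = insert i ({..<N - 1} - {i} - {j})"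
    using ij by auto
  then have lc: "last_coord \<E> N (x(i := u, j := v)) = t x - u - v" for u v
    by (subst last_coord_fun_upd[OF ij(2)])
       (simp add: t_def sum_fun_upd_other del: fun_upd_apply, simp add: algebra_simps)
  have N: "i < N" "j < N" "0 < N" "i \<noteq> N - 1" "j \<noteq> N - 1"
    using ij by auto
  have s: "complete_cfg \<E> N (x(i := u, j := v)) i + complete_cfg \<E> N (x(i := u, j := v)) j
       + complete_cfg \<E> N (x(i := u, j := v)) (N - 1) = t x"
    using ij N by (simp add: complete_cfg_apply lc)
  show ?thesis
    using ij N unfolding S_op_def s
    by (auto simp: fun_eq_iff complete_cfg_apply lc simplex_point_simps algebra_simps)
qed

lemma nn_integral_S_op_measurable:
  assumes "\<gamma> > 0" "i < N" "j < N" "k < N" and F: "F \<in> borel_measurable (cfg_space N)"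
  shows "(\<lambda>x. \<integral>\<^sup>+ y. F (S_op i j k y x) \<partial>nu_cond \<gamma> (1 / 3) 3) \<in> borel_measurable (cfg_space N)"
proof -
  interpret sigma_finite_measure "nu_cond \<gamma> (1 / 3) 3"
    by (rule prob_space_imp_sigma_finite[OF prob_space_nu_3]) fact
  have "(\<lambda>(x, y). F (S_op i j k y x)) \<in> borel_measurable (cfg_space N \<Otimes>\<^sub>M nu_cond \<gamma> (1 / 3) 3)"
    using measurable_compose[OF S_op_measurable[OF assms(2-4)] F]
    by (simp add: case_prod_unfold cong: measurable_cong_sets)
  then show ?thesis
    by (rule borel_measurable_nn_integral)
qed

text \<open>By \<open>S_op_complete_cfg\<close> the inner average is a constant in \<open>u\<close>
  and \<open>v\<close>, namely \<open>c / ?B\<close>. Integrating a constant over the triple gives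
  back the mass \<open>?B\<close> and the power of the total, and the same power comes from scaling
  the original integrand.\<close>

lemma simplex_nn_resample3_last:
  assumes g: "\<gamma> > 0" and ij: "i < N - 1" "j < N - 1" "i \<noteq> j" 
    and F: "F \<in> borel_measurable (cfg_space N)"
  shows "simplex_nn \<gamma> \<E> N (\<lambda>x. \<integral>\<^sup>+ y. F (S_op i j (N - 1) y x) \<partial>nu_cond \<gamma> (1 / 3) 3) = simplex_nn \<gamma> \<E> N F"
proof -
  have N: "i < N" "j < N" "N - 1 < N"
    using ij by auto
  define J where "J = {..<N - 1} - {i} - {j}"
  show ?thesis
    unfolding simplex_nn_split2[OF ij nn_integral_S_op_measurable[OF g N F]] simplex_nn_split2[OF ij F]
  proof (rule nn_integral_cong, rule arg_cong2[where f = "(*)", OF refl], fold J_def)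
    fix x assume x: "x \<in> space (PiM J (\<lambda>_. lborel :: real measure))"
    let ?t = "N * \<E> - (\<Sum>k\<in>J. x k)"
    let ?B = "ennreal (Beta \<gamma> (2 * \<gamma>) * Beta \<gamma> \<gamma>)"
    have upd: "(\<lambda>(u, v). x(i := u, j := v)) \<in> borel \<Otimes>\<^sub>M borel \<rightarrow>\<^sub>M PiM {..<N - 1} (\<lambda>_. lborel :: real measure)"
    proof (rule measurable_PiM_single')
      fix k assume "k \<in> {..<N - 1}"
      then show "(\<lambda>p. (case p of (u, v) \<Rightarrow> x(i := u, j := v)) k) \<in> borel \<Otimes>\<^sub>M borel \<rightarrow>\<^sub>M lborel"
        by (cases "k = j"; cases "k = i") (simp_all add: case_prod_unfold)
    qed (use x ij in \<open>auto simp: space_PiM PiE_iff extensional_def J_def split: if_splits\<close>)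
    have meas: "(\<lambda>(u, v). F (complete_cfg \<E> N (x(i := u, j := v)))) \<in> borel_measurable (borel \<Otimes>\<^sub>M borel)"
      using measurable_compose[OF measurable_compose[OF upd complete_cfg_measurable] F] by (simp add: case_prod_unfold)
    show "triple_nn \<gamma> ?t (\<lambda>u v. \<integral>\<^sup>+ y. F (S_op i j (N - 1) y (complete_cfg \<E> N (x(i := u, j := v)))) \<partial>nu_cond \<gamma> (1 / 3) 3) =
      triple_nn \<gamma> ?t (\<lambda>u v. F (complete_cfg \<E> N (x(i := u, j := v))))"
    proof (cases "?t > 0")
      case True
      define c where "c = triple_nn \<gamma> 1 (\<lambda>u v. F (complete_cfg \<E> N (x(i := ?t * u, j := ?t * v))))"
      have B: "?B \<noteq> 0" "?B \<noteq> top"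
        using triple_total_pos[OF g] by auto
      have inner: "(\<integral>\<^sup>+ y. F (S_op i j (N - 1) y (complete_cfg \<E> N (x(i := u, j := v)))) \<partial>nu_cond \<gamma> (1 / 3) 3) = c / ?B" for u v
      proof -
        have "complete_cfg \<E> N (x(i := u, j := v)) \<in> space (cfg_space N)"
          by (auto simp: cfg_space_def space_PiM complete_cfg_def)
        then have "(\<integral>\<^sup>+ y. F (S_op i j (N - 1) y (complete_cfg \<E> N (x(i := u, j := v)))) \<partial>nu_cond \<gamma> (1 / 3) 3) * ?B = c"
          unfolding c_def
          by (subst nn_integral_nu_3[OF g measurable_compose[OF S_op_measurable_param[OF N] F]])
             (simp_all only: S_op_complete_cfg[OF ij] J_def)
        then show ?thesis
          using B by (metis ennreal_mult_divide_eq)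
      qed
      have "triple_nn \<gamma> ?t (\<lambda>u v. c / ?B) = ennreal (?t powr (3 * \<gamma> - 1)) * triple_nn \<gamma> 1 (\<lambda>u v. c / ?B)"
        using True by (rule triple_nn_scale) simp
      also have "triple_nn \<gamma> 1 (\<lambda>u v. c / ?B) = ?B * (c / ?B)"
        unfolding triple_nn_total[OF g, symmetric]
        unfolding triple_nn_def by (simp add: nn_integral_multc)
      also have "\<dots> = c"
        using B by (simp add: ennreal_times_divide mult.commute[of ?B] ennreal_mult_divide_eq)
      also have "ennreal (?t powr (3 * \<gamma> - 1)) * c = triple_nn \<gamma> ?t (\<lambda>u v. F (complete_cfg \<E> N (x(i := u, j := v))))"
        unfolding c_def using triple_nn_scale[OF True meas] by simp
      finally show ?thesis
        unfolding inner .
    qed (simp add: triple_nn_nonpos)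
  qed
qed

section \<open>Invariance for arbitrary pairs and triples\<close>

lemma nn_integral_nu_cong_simplex_nn:
  assumes "F \<in> borel_measurable (cfg_space N)" "G \<in> borel_measurable (cfg_space N)"
    and "simplex_nn \<gamma> \<E> N F = simplex_nn \<gamma> \<E> N G"
  shows "(\<integral>\<^sup>+ x. F x \<partial>nu_cond \<gamma> \<E> N) = (\<integral>\<^sup>+ x. G x \<partial>nu_cond \<gamma> \<E> N)"
  using assms by (simp only: nn_integral_nu_cond)

lemma nn_integral_nu_swap_last:
  assumes "b < N - 1" "F \<in> borel_measurable (cfg_space N)"
  shows "(\<integral>\<^sup>+ x. F (x \<circ> swap_last N b) \<partial>nu_cond \<gamma> \<E> N) = (\<integral>\<^sup>+ x. F x \<partial>nu_cond \<gamma> \<E> N)"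
  using assms
  by (intro nn_integral_nu_cong_simplex_nn simplex_nn_swap_last measurable_compose[OF swap_last_measurable]) auto

lemma T_op_transpose:
  "T_op i j a x \<circ> Transposition.transpose b c =
     T_op (Transposition.transpose b c i) (Transposition.transpose b c j) a (x \<circ> Transposition.transpose b c)"
  by (auto simp: T_op_def fun_eq_iff Transposition.transpose_def)

lemma S_op_transpose:
  "S_op i j k y x \<circ> Transposition.transpose b c =
     S_op (Transposition.transpose b c i) (Transposition.transpose b c j) (Transposition.transpose b c k) y
       (x \<circ> Transposition.transpose b c)"
  by (auto simp: S_op_def fun_eq_iff Transposition.transpose_def)

lemma nn_integral_nu_resample_last:
  assumes "\<gamma> > 0" "i < N - 1" "F \<in> borel_measurable (cfg_space N)"
  shows "(\<integral>\<^sup>+ x. \<integral>\<^sup>+ a. F (T_op i (N - 1) a x) \<partial>mu_beta \<gamma> \<partial>nu_cond \<gamma> \<E> N) = (\<integral>\<^sup>+ x. F x \<partial>nu_cond \<gamma> \<E> N)"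
  using assms
  by (intro nn_integral_nu_cong_simplex_nn simplex_nn_resample_last nn_integral_T_op_measurable) auto

lemma comp_transpose_comp_transpose [simp]:
  "x \<circ> Transposition.transpose b c \<circ> Transposition.transpose b c = x"
  by (simp add: fun_eq_iff)

text \<open>Conjugation by the transposition of \<open>j\<close> and \<open>N - 1\<close> turns the
  pair into one that contains the last site.\<close>

lemma nn_integral_nu_resample:
  assumes g: "\<gamma> > 0" and ij: "i < N" "j < N" "i \<noteq> j" and F: "F \<in> borel_measurable (cfg_space N)"
  shows "(\<integral>\<^sup>+ x. \<integral>\<^sup>+ a. F (T_op i j a x) \<partial>mu_beta \<gamma> \<partial>nu_cond \<gamma> \<E> N) = (\<integral>\<^sup>+ x. F x \<partial>nu_cond \<gamma> \<E> N)"
proof (cases "j = N - 1")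
  case True
  then show ?thesis
    using nn_integral_nu_resample_last[OF g _ F, of i] ij by auto
next
  case False
  define s where "s = swap_last N j"
  \<comment> \<open>If \<open>i\<close> is itself the last site, the transposition sends it to
    \<open>j\<close>; thus \<open>k\<close> is below \<open>N - 1\<close> in every case.\<close>
  define k where "k = s i"
  have j: "j < N - 1" and k: "k < N - 1" and s: "s k = i" "s (N - 1) = j"
    using False ij by (auto simp: s_def k_def Transposition.transpose_def)
  define F' where "F' x = F (x \<circ> s)" for x
  have F': "F' \<in> borel_measurable (cfg_space N)"
    unfolding F'_def s_def using measurable_compose[OF swap_last_measurable[OF j] F] .
  have kN: "k < N" "N - 1 < N"
    using k by auto
  have "(\<integral>\<^sup>+ x. F x \<partial>nu_cond \<gamma> \<E> N) = (\<integral>\<^sup>+ x. F' x \<partial>nu_cond \<gamma> \<E> N)"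
    unfolding F'_def s_def by (rule nn_integral_nu_swap_last[OF j F, symmetric])
  also have "\<dots> = (\<integral>\<^sup>+ x. \<integral>\<^sup>+ a. F' (T_op k (N - 1) a x) \<partial>mu_beta \<gamma> \<partial>nu_cond \<gamma> \<E> N)"
    by (rule nn_integral_nu_resample_last[OF g k F', symmetric])
  also have "\<dots> = (\<integral>\<^sup>+ x. \<integral>\<^sup>+ a. F' (T_op k (N - 1) a (x \<circ> s)) \<partial>mu_beta \<gamma> \<partial>nu_cond \<gamma> \<E> N)"
    unfolding s_def
    by (rule nn_integral_nu_swap_last[OF j nn_integral_T_op_measurable[OF g kN F'], symmetric])
  also have "\<dots> = (\<integral>\<^sup>+ x. \<integral>\<^sup>+ a. F (T_op i j a x) \<partial>mu_beta \<gamma> \<partial>nu_cond \<gamma> \<E> N)"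
  proof -
    have "F' (T_op k (N - 1) a (x \<circ> s)) = F (T_op i j a x)" for a x
      unfolding F'_def using s unfolding s_def by (simp only: T_op_transpose comp_transpose_comp_transpose)
    then show ?thesis
      by (simp only:)
  qed
  finally show ?thesis ..
qed

text \<open>Conjugation again, now moving \<open>l\<close> to the last place; \<open>p\<close> and
  \<open>q\<close> absorb the case that \<open>i\<close> or \<open>j\<close> was the last
  site.\<close>

lemma nn_integral_nu_resample3:
  assumes g: "\<gamma> > 0" and ijl: "i < N" "j < N" "l < N" "i \<noteq> j" "i \<noteq> l" "j \<noteq> l"
    and F: "F \<in> borel_measurable (cfg_space N)"
  shows "(\<integral>\<^sup>+ x. \<integral>\<^sup>+ y. F (S_op i j l y x) \<partial>nu_cond \<gamma> (1 / 3) 3 \<partial>nu_cond \<gamma> \<E> N) = (\<integral>\<^sup>+ x. F x \<partial>nu_cond \<gamma> \<E> N)"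
proof -
  have last: "(\<integral>\<^sup>+ x. \<integral>\<^sup>+ y. H (S_op p q (N - 1) y x) \<partial>nu_cond \<gamma> (1 / 3) 3 \<partial>nu_cond \<gamma> \<E> N) = (\<integral>\<^sup>+ x. H x \<partial>nu_cond \<gamma> \<E> N)"
    if "p < N - 1" "q < N - 1" "p \<noteq> q" "H \<in> borel_measurable (cfg_space N)" for p q H
    using g that
    by (intro nn_integral_nu_cong_simplex_nn simplex_nn_resample3_last nn_integral_S_op_measurable) auto
  show ?thesis
  proof (cases "l = N - 1")
    case True
    then show ?thesis
      using last[OF _ _ _ F, of i j] ijl by auto
  next
    case False
    define s where "s = swap_last N l"
    define p where "p = s i"
    define q where "q = s j"
    have l: "l < N - 1" and p: "p < N - 1" and q: "q < N - 1" and pq: "p \<noteq> q"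
      and s: "s p = i" "s q = j" "s (N - 1) = l"
      using False ijl by (auto simp: s_def p_def q_def Transposition.transpose_def)
    define F' where "F' x = F (x \<circ> s)" for x
    have F': "F' \<in> borel_measurable (cfg_space N)"
      unfolding F'_def s_def using measurable_compose[OF swap_last_measurable[OF l] F] .
    have N: "p < N" "q < N" "N - 1 < N"
      using p q by auto
    have "(\<integral>\<^sup>+ x. F x \<partial>nu_cond \<gamma> \<E> N) = (\<integral>\<^sup>+ x. F' x \<partial>nu_cond \<gamma> \<E> N)"
      unfolding F'_def s_def by (rule nn_integral_nu_swap_last[OF l F, symmetric])
    also have "\<dots> = (\<integral>\<^sup>+ x. \<integral>\<^sup>+ y. F' (S_op p q (N - 1) y x) \<partial>nu_cond \<gamma> (1 / 3) 3 \<partial>nu_cond \<gamma> \<E> N)"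
      by (rule last[OF p q pq F', symmetric])
    also have "\<dots> = (\<integral>\<^sup>+ x. \<integral>\<^sup>+ y. F' (S_op p q (N - 1) y (x \<circ> s)) \<partial>nu_cond \<gamma> (1 / 3) 3 \<partial>nu_cond \<gamma> \<E> N)"
      unfolding s_def
      by (rule nn_integral_nu_swap_last[OF l nn_integral_S_op_measurable[OF g N F'], symmetric])
    also have "\<dots> = (\<integral>\<^sup>+ x. \<integral>\<^sup>+ y. F (S_op i j l y x) \<partial>nu_cond \<gamma> (1 / 3) 3 \<partial>nu_cond \<gamma> \<E> N)"
    proof -
      have "F' (S_op p q (N - 1) y (x \<circ> s)) = F (S_op i j l y x)" for y x
        unfolding F'_def using s unfolding s_def by (simp only: S_op_transpose comp_transpose_comp_transpose)
      then show ?thesis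
        by (simp only:)
    qed
    finally show ?thesis ..
  qed
qed

text \<open>A nonzero density forces the first \<open>N - 1\<close> coordinates and the completed
  one to be positive, and the completed one is chosen to make the sum right.\<close>

lemma AE_nu_cond:
  assumes N: "N \<ge> 1"
  shows "AE x in nu_cond \<gamma> \<E> N. (\<forall>k<N. 0 < x k) \<and> (\<Sum>k<N. x k) = N * \<E>"
proof -
  have complete: "(\<forall>k<N. 0 < complete_cfg \<E> N y k) \<and> (\<Sum>k<N. complete_cfg \<E> N y k) = N * \<E>"
    if "simplex_dens \<gamma> \<E> N y \<noteq> 0" for y
  proof -
    have pos: "\<forall>k<N - 1. 0 < y k" "0 < last_coord \<E> N y"
      using that by (auto simp: simplex_dens_def split: if_splits)
    have "(\<Sum>k<N. complete_cfg \<E> N y k) = (\<Sum>k<Suc (N - 1). complete_cfg \<E> N y k)"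
      using N by simp
    also have "\<dots> = (\<Sum>k<N - 1. y k) + last_coord \<E> N y"
      using N by (subst sum.lessThan_Suc) (auto simp: complete_cfg_apply intro!: sum.cong)
    finally show ?thesis
      using pos by (auto simp: complete_cfg_apply last_coord_def)
  qed
  have pos: "(\<forall>k<N. 0 < complete_cfg \<E> N y k) \<and> (\<Sum>k<N. complete_cfg \<E> N y k) = N * \<E>"
    if "0 < ennreal (simplex_dens \<gamma> \<E> N y) / Z" for y Z
    using that complete[of y] by (cases "simplex_dens \<gamma> \<E> N y = 0") auto
  have coord [measurable]: "(\<lambda>x. x k) \<in> borel_measurable (cfg_space N)" if "k < N" for k
    using that by (rule measurable_cfg_space_coord)
  have m1: "{x \<in> space (cfg_space N). \<forall>k<N. 0 < x k} \<in> sets (cfg_space N)"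
  proof -
    have "{x \<in> space (cfg_space N). \<forall>k<N. 0 < x k} = {x \<in> space (cfg_space N). \<forall>k\<in>{..<N}. 0 < x k}"
      by auto
    also have "\<dots> \<in> sets (cfg_space N)"
      by (intro sets.sets_Collect_finite_All' borel_measurable_less coord) (use N in \<open>auto simp: lessThan_empty_iff bot_nat_def\<close>)
    finally show ?thesis .
  qed
  have m2: "{x \<in> space (cfg_space N). (\<Sum>k<N. x k) = N * \<E>} \<in> sets (cfg_space N)"
    by (intro borel_measurable_eq borel_measurable_sum borel_measurable_const coord) auto
  have meas: "{x \<in> space (cfg_space N). (\<forall>k<N. 0 < x k) \<and> (\<Sum>k<N. x k) = N * \<E>} \<in> sets (cfg_space N)"
    using sets.sets_Collect_conj[OF m2 m1] by (simp add: conj_commute)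
  have "(\<lambda>y. ennreal (simplex_dens \<gamma> \<E> N y) / (\<integral>\<^sup>+ z. ennreal (simplex_dens \<gamma> \<E> N z) \<partial>PiM {..<N - 1} (\<lambda>_. lborel)))
      \<in> borel_measurable (PiM {..<N - 1} (\<lambda>_. lborel))"
    by measurable
  then show ?thesis
    unfolding nu_cond_def
    by (subst AE_distr_iff) (auto simp: AE_density meas dest: pos)
qed

subsection \<open>The three-site gap\<close>

lemma borel_measurable_nu_cond [simp]:
  "borel_measurable (nu_cond \<gamma> \<E> N) = borel_measurable (cfg_space N)"
  by (simp cong: measurable_cong_sets)

lemma borel_measurable_mu_beta [simp]: "borel_measurable (mu_beta \<gamma>) = borel_measurable borel"
  by (simp cong: measurable_cong_sets)

text \<open>A pair resampling keeps the pair total and forgets how it was divided. Hence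
  \<open>E_op\<close> of a function is constant along the resampling, as a conditional expectation
  should be.\<close>

lemma T_op_T_op: "i \<noteq> j \<Longrightarrow> T_op i j b (T_op i j a x) = T_op i j b x"
  by (auto simp: T_op_def fun_eq_iff algebra_simps)

lemma T_op_flip: "i \<noteq> j \<Longrightarrow> T_op i j (1 - a) x = T_op j i a x"
  by (auto simp: T_op_def fun_eq_iff algebra_simps)

lemma D_op_measurable:
  assumes "\<gamma> > 0" "i < N" "j < N" and f: "f \<in> borel_measurable (cfg_space N)"
  shows "D_op \<gamma> i j f \<in> borel_measurable (cfg_space N)"
proof -
  interpret sigma_finite_measure "mu_beta \<gamma>"
    by (rule sigma_finite_mu_beta) fact
  have "(\<lambda>(x, a). f (T_op i j a x)) \<in> borel_measurable (cfg_space N \<Otimes>\<^sub>M mu_beta \<gamma>)"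
    using measurable_compose[OF T_op_measurable[OF assms(2,3)] f]
    by (simp add: case_prod_unfold cong: measurable_cong_sets)
  from borel_measurable_lebesgue_integral[OF this] f show ?thesis
    unfolding D_op_def[abs_def] E_op_def by (rule borel_measurable_diff)
qed

lemma D_op_commute:
  assumes g: "\<gamma> > 0" and ij: "i < N" "j < N" "i \<noteq> j" and f: "f \<in> borel_measurable (cfg_space N)"
    and x: "x \<in> space (cfg_space N)"
  shows "D_op \<gamma> i j f x = D_op \<gamma> j i f x"
proof -
  have "E_op \<gamma> j i f x = (\<integral>a. f (T_op i j (1 - a) x) \<partial>mu_beta \<gamma>)"
    unfolding E_op_def by (simp add: T_op_flip[OF ij(3)])
  also have "\<dots> = (\<integral>a. f (T_op i j a x) \<partial>distr (mu_beta \<gamma>) borel (\<lambda>a. 1 - a))"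
    using measurable_compose[OF T_op_measurable_param[OF ij(1,2) x] f]
    by (subst integral_distr) simp_all
  also have "\<dots> = E_op \<gamma> i j f x"
    unfolding distr_mu_beta_flip[OF g] E_op_def ..
  finally show ?thesis
    by (simp add: D_op_def)
qed

text \<open>With an infinite second moment the bound is trivial, whatever default value
  \<open>expectation X\<close> takes. Otherwise \<open>X\<close> is integrable and the usual
  variance formula applies.\<close>

lemma (in prob_space) nn_variance_le_second_moment:
  fixes X :: "'a \<Rightarrow> real"
  assumes [measurable]: "random_variable borel X"
  shows "(\<integral>\<^sup>+ a. ennreal ((expectation X - X a)\<^sup>2) \<partial>M) \<le> (\<integral>\<^sup>+ a. ennreal ((X a)\<^sup>2) \<partial>M)"
proof (cases "(\<integral>\<^sup>+ a. ennreal ((X a)\<^sup>2) \<partial>M) = \<infinity>")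
  case False
  then have X2: "integrable M (\<lambda>a. (X a)\<^sup>2)"
    by (intro integrableI_nonneg) (auto simp: less_top)
  then have X: "integrable M X"
    by (rule square_integrable_imp_integrable[rotated]) simp
  have dev: "integrable M (\<lambda>a. (expectation X - X a)\<^sup>2)"
    using X X2 by (simp add: power2_diff)
  have "expectation (\<lambda>a. (expectation X - X a)\<^sup>2) = variance X"
    by (simp add: power2_commute)
  also have "\<dots> \<le> expectation (\<lambda>a. (X a)\<^sup>2)"
    using variance_eq[OF X X2] by simp
  finally show ?thesis
    using X2 dev by (simp add: nn_integral_eq_integral)
qed simp

text \<open>Since \<open>E_op\<close> averages over a resampling that preserves the measure, \<open>D_op\<close> is a conditional
  centring, hence a contraction.\<close>

lemma D_op_contraction:
  assumes g: "\<gamma> > 0" and ij: "i < N" "j < N" "i \<noteq> j" and f: "f \<in> borel_measurable (cfg_space N)"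
  shows "(\<integral>\<^sup>+ x. ennreal ((D_op \<gamma> i j f x)\<^sup>2) \<partial>nu_cond \<gamma> \<E> N) \<le> (\<integral>\<^sup>+ x. ennreal ((f x)\<^sup>2) \<partial>nu_cond \<gamma> \<E> N)"
proof -
  interpret mu: prob_space "mu_beta \<gamma>"
    by (rule prob_space_mu_beta) fact
  note [measurable] = D_op_measurable[OF g ij(1,2) f] f
  have "(\<integral>\<^sup>+ x. ennreal ((D_op \<gamma> i j f x)\<^sup>2) \<partial>nu_cond \<gamma> \<E> N) =
    (\<integral>\<^sup>+ x. \<integral>\<^sup>+ a. ennreal ((D_op \<gamma> i j f (T_op i j a x))\<^sup>2) \<partial>mu_beta \<gamma> \<partial>nu_cond \<gamma> \<E> N)"
    by (rule nn_integral_nu_resample[OF g ij, symmetric]) measurable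
  also have "\<dots> \<le> (\<integral>\<^sup>+ x. \<integral>\<^sup>+ a. ennreal ((f (T_op i j a x))\<^sup>2) \<partial>mu_beta \<gamma> \<partial>nu_cond \<gamma> \<E> N)"
  proof (rule nn_integral_mono)
    fix x assume "x \<in> space (nu_cond \<gamma> \<E> N)"
    then have "(\<lambda>a. f (T_op i j a x)) \<in> borel_measurable (mu_beta \<gamma>)"
      using measurable_compose[OF T_op_measurable_param[OF ij(1,2)] f] by (simp cong: measurable_cong_sets)
    from mu.nn_variance_le_second_moment[OF this]
    show "(\<integral>\<^sup>+ a. ennreal ((D_op \<gamma> i j f (T_op i j a x))\<^sup>2) \<partial>mu_beta \<gamma>) \<le>
        (\<integral>\<^sup>+ a. ennreal ((f (T_op i j a x))\<^sup>2) \<partial>mu_beta \<gamma>)"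
      by (simp add: D_op_def E_op_def T_op_T_op[OF ij(3)])
  qed
  also have "\<dots> = (\<integral>\<^sup>+ x. ennreal ((f x)\<^sup>2) \<partial>nu_cond \<gamma> \<E> N)"
    by (rule nn_integral_nu_resample[OF g ij]) measurable
  finally show ?thesis .
qed

text \<open>The constant cancels only where \<open>f\<close> is integrable along the resampling of
  the pair; elsewhere the integral in \<open>E_op\<close> takes the default value 0. Invariance
  turns the finite second moment into finiteness of almost every such average of the square, which
  gives integrability there.\<close>

lemma AE_D_op_diff_const:
  assumes g: "\<gamma> > 0" and ij: "i < N" "j < N" "i \<noteq> j" and f: "f \<in> borel_measurable (cfg_space N)"
    and fin: "(\<integral>\<^sup>+ x. ennreal ((f x)\<^sup>2) \<partial>nu_cond \<gamma> \<E> N) < \<infinity>"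
  shows "AE x in nu_cond \<gamma> \<E> N. D_op \<gamma> i j (\<lambda>x. f x - c) x = D_op \<gamma> i j f x"
proof -
  interpret mu: prob_space "mu_beta \<gamma>"
    by (rule prob_space_mu_beta) fact
  have f2: "(\<lambda>x. ennreal ((f x)\<^sup>2)) \<in> borel_measurable (cfg_space N)"
    using f by measurable
  have m: "(\<lambda>x. \<integral>\<^sup>+ a. ennreal ((f (T_op i j a x))\<^sup>2) \<partial>mu_beta \<gamma>) \<in> borel_measurable (nu_cond \<gamma> \<E> N)"
    using nn_integral_T_op_measurable[OF g ij(1,2) f2] by (simp cong: measurable_cong_sets)
  have "AE x in nu_cond \<gamma> \<E> N. (\<integral>\<^sup>+ a. ennreal ((f (T_op i j a x))\<^sup>2) \<partial>mu_beta \<gamma>) \<noteq> \<infinity>"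
    using fin by (intro nn_integral_noteq_infinite m) (simp add: nn_integral_nu_resample[OF g ij f2])
  then show ?thesis
  proof (rule AE_mp, intro AE_I2 impI)
    fix x assume x: "x \<in> space (nu_cond \<gamma> \<E> N)"
      and fx: "(\<integral>\<^sup>+ a. ennreal ((f (T_op i j a x))\<^sup>2) \<partial>mu_beta \<gamma>) \<noteq> \<infinity>"
    have [measurable]: "(\<lambda>a. f (T_op i j a x)) \<in> borel_measurable (mu_beta \<gamma>)"
      using x measurable_compose[OF T_op_measurable_param[OF ij(1,2)] f] by (simp cong: measurable_cong_sets)
    have "integrable (mu_beta \<gamma>) (\<lambda>a. (f (T_op i j a x))\<^sup>2)"
      using fx by (intro integrableI_nonneg) (auto simp: less_top)
    then have "integrable (mu_beta \<gamma>) (\<lambda>a. f (T_op i j a x))"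
      by (rule mu.square_integrable_imp_integrable[rotated]) simp
    then show "D_op \<gamma> i j (\<lambda>x. f x - c) x = D_op \<gamma> i j f x"
      by (simp add: D_op_def E_op_def mu.prob_space[simplified])
  qed
qed

lemma dir_nn_3:
  "dir_nn \<gamma> m \<E> 3 h =
     (\<integral>\<^sup>+ y. ennreal ((y 0 + y 1) powr m * (D_op \<gamma> 0 1 h y)\<^sup>2) \<partial>nu_cond \<gamma> \<E> 3) +
     (\<integral>\<^sup>+ y. ennreal ((y 1 + y 2) powr m * (D_op \<gamma> 1 2 h y)\<^sup>2) \<partial>nu_cond \<gamma> \<E> 3)"
proof -
  have "{..<3 - 1} = {0, 1::nat}" and "1 + 1 = (2::nat)" and "0 + 1 = (1::nat)"
    by auto
  then show ?thesis
    unfolding dir_nn_def by (simp add: numeral_2_eq_2)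
qed

text \<open>\<open>kappa\<close> bounds a variance, and contraction applied to the centred function
  bounds the left side by that variance. Keeping \<open>D_op\<close> rather than the variance leaves
  a term that refers to one pair and can later be summed over pairs.\<close>

lemma kappa_contraction:
  assumes g: "\<gamma> > 0" and h: "h \<in> borel_measurable (cfg_space 3)"
    and fin: "(\<integral>\<^sup>+ y. ennreal ((h y)\<^sup>2) \<partial>nu_cond \<gamma> (1 / 3) 3) < \<infinity>"
  shows "kappa \<gamma> m * (\<integral>\<^sup>+ y. ennreal ((D_op \<gamma> 0 1 h y)\<^sup>2) \<partial>nu_cond \<gamma> (1 / 3) 3) \<le> dir_nn \<gamma> m (1 / 3) 3 h"
proof -
  let ?nu = "nu_cond \<gamma> (1 / 3) 3"
  interpret nu: prob_space ?nu
    by (rule prob_space_nu_3) fact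
  define c where "c = (\<integral>y. h y \<partial>?nu)"
  define h' where "h' y = h y - c" for y
  have h' [measurable]: "h' \<in> borel_measurable (cfg_space 3)"
    unfolding h'_def using h by measurable
  have h2: "integrable ?nu (\<lambda>y. (h y)\<^sup>2)"
    by (rule integrableI_nonneg) (use fin h in simp_all)
  have h1: "integrable ?nu h"
    by (rule nu.square_integrable_imp_integrable) (use h h2 in simp_all)
  have h'2: "integrable ?nu (\<lambda>y. (h' y)\<^sup>2)"
    unfolding h'_def using h1 h2 by (simp add: power2_diff)
  have mean: "(\<integral>y. h' y \<partial>?nu) = 0"
    unfolding h'_def using h1 nu.prob_space by (simp add: c_def)
  have D01: "AE y in ?nu. D_op \<gamma> 0 1 h' y = D_op \<gamma> 0 1 h y"
    and D12: "AE y in ?nu. D_op \<gamma> 1 2 h' y = D_op \<gamma> 1 2 h y"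
    unfolding h'_def[abs_def] by (rule AE_D_op_diff_const[OF g _ _ _ h fin]; simp)+
  have dir: "dir_nn \<gamma> m (1 / 3) 3 h' = dir_nn \<gamma> m (1 / 3) 3 h"
    unfolding dir_nn_3
    by (intro arg_cong2[where f = "(+)"] nn_integral_cong_AE) (use D01 D12 in auto)
  have "(\<integral>\<^sup>+ y. ennreal ((D_op \<gamma> 0 1 h y)\<^sup>2) \<partial>?nu) = (\<integral>\<^sup>+ y. ennreal ((D_op \<gamma> 0 1 h' y)\<^sup>2) \<partial>?nu)"
    by (intro nn_integral_cong_AE) (use D01 in auto)
  also have "\<dots> \<le> (\<integral>\<^sup>+ y. ennreal ((h' y)\<^sup>2) \<partial>?nu)"
    by (rule D_op_contraction[OF g _ _ _ h']) auto
  also have "\<dots> = ennreal (\<integral>y. (h' y)\<^sup>2 \<partial>?nu)"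
    using h'2 by (simp add: nn_integral_eq_integral)
  finally have le: "(\<integral>\<^sup>+ y. ennreal ((D_op \<gamma> 0 1 h y)\<^sup>2) \<partial>?nu) \<le> ennreal (\<integral>y. (h' y)\<^sup>2 \<partial>?nu)" .
  show ?thesis
  \<comment> \<open>A function of zero norm is not admissible in the infimum; then contraction
    already makes the left side vanish.\<close>
  proof (cases "(\<integral>y. (h' y)\<^sup>2 \<partial>?nu) = 0")
    case True
    then show ?thesis
      using le by simp
  next
    case False
    then have pos: "(\<integral>y. (h' y)\<^sup>2 \<partial>?nu) > 0"
      by (simp add: less_le)
    have "h' \<in> test_fns \<gamma> (1 / 3) 3"
      using h' h'2 mean False by (simp add: test_fns_def)
    then have "kappa \<gamma> m \<le> dir_nn \<gamma> m (1 / 3) 3 h' / ennreal (\<integral>y. (h' y)\<^sup>2 \<partial>?nu)"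
      unfolding kappa_def gap_nn_def by (rule INF_lower)
    then have "kappa \<gamma> m * ennreal (\<integral>y. (h' y)\<^sup>2 \<partial>?nu) \<le>
       dir_nn \<gamma> m (1 / 3) 3 h' / ennreal (\<integral>y. (h' y)\<^sup>2 \<partial>?nu) * ennreal (\<integral>y. (h' y)\<^sup>2 \<partial>?nu)"
      by (rule mult_right_mono) simp
    also have "\<dots> = dir_nn \<gamma> m (1 / 3) 3 h"
      using pos by (simp add: dir ennreal_divide_times ennreal_divide_self)
    finally show ?thesis
      using le by (meson mult_left_mono order_trans zero_le)
  qed
qed

text \<open>The centred first coordinate serves as test function. The form has two terms, each with
  a weight of at most 1 because the total mass is 1, and contraction bounds each by the variance. An
  explicit nonconstant function is required, since an infimum over the empty set would be
  infinite.\<close>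

lemma kappa_le_2:
  assumes g: "\<gamma> > 0" and m: "m \<ge> 0"
  shows "kappa \<gamma> m \<le> 2"
proof -
  let ?nu = "nu_cond \<gamma> (1 / 3) 3"
  interpret nu: prob_space ?nu
    by (rule prob_space_nu_3) fact
  interpret mu: prob_space "mu_beta \<gamma>"
    by (rule prob_space_mu_beta) fact
  have ae: "AE y in ?nu. (\<forall>k<3. 0 < y k) \<and> (\<Sum>k<3. y k) = 1"
    using AE_nu_cond[of 3 "1 / 3" \<gamma>] by simp
  have ae: "AE y in ?nu. 0 < y 0 \<and> 0 < y 1 \<and> 0 < y 2 \<and> y 0 + y 1 + y 2 = 1"
    using ae by eventually_elim (auto simp: numeral_3_eq_3 numeral_2_eq_2)
  have y0 [measurable]: "(\<lambda>y. y 0) \<in> borel_measurable (cfg_space 3)"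
    by (rule measurable_cfg_space_coord) simp
  have int0: "integrable ?nu (\<lambda>y. y 0)"
    by (rule nu.integrable_const_bound[of _ 1]) (use ae in auto)
  define c where "c = (\<integral>y. y 0 \<partial>?nu)"
  define f where "f y = y 0 - c" for y :: "nat \<Rightarrow> real"
  have f [measurable]: "f \<in> borel_measurable (cfg_space 3)"
    unfolding f_def by measurable
  have bound: "AE y in ?nu. (y 0)\<^sup>2 \<le> 1"
    using ae by eventually_elim (auto simp: power_le_one_iff)
  have int02: "integrable ?nu (\<lambda>y. (y 0)\<^sup>2)"
    by (rule nu.integrable_const_bound[of _ 1]) (use bound in auto)
  have f2: "integrable ?nu (\<lambda>y. (f y)\<^sup>2)"
    unfolding f_def using int0 int02 by (simp add: power2_diff)
  have mean: "(\<integral>y. f y \<partial>?nu) = 0"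
    unfolding f_def using int0 nu.prob_space by (simp add: c_def)
  have var: "(\<integral>y. (f y)\<^sup>2 \<partial>?nu) \<noteq> 0"
  proof
    assume "(\<integral>y. (f y)\<^sup>2 \<partial>?nu) = 0"
    then have "(\<integral>\<^sup>+ y. ennreal ((f y)\<^sup>2) \<partial>?nu) = 0"
      using f2 by (simp add: nn_integral_eq_integral)
    moreover have m2: "(\<lambda>y. ennreal ((f y)\<^sup>2)) \<in> borel_measurable (cfg_space 3)"
      by measurable
    \<comment> \<open>If \<open>f\<close> vanished almost everywhere, so would its resampling. But
      at fixed \<open>y\<close> this is affine in \<open>a\<close> with slope
      \<open>y 0 + y 1 > 0\<close>, so it has one zero, and the Beta law has no atoms.\<close>
    ultimately have "(\<integral>\<^sup>+ y. \<integral>\<^sup>+ a. ennreal ((f (T_op 0 1 a y))\<^sup>2) \<partial>mu_beta \<gamma> \<partial>?nu) = 0"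
      by (subst nn_integral_nu_resample[OF g]) auto
    then have "AE y in ?nu. (\<integral>\<^sup>+ a. ennreal ((f (T_op 0 1 a y))\<^sup>2) \<partial>mu_beta \<gamma>) = 0"
      using nn_integral_T_op_measurable[OF g _ _ m2, of 0 1]
      by (subst (asm) nn_integral_0_iff_AE) auto
    then have "AE y in ?nu. False"
      using ae
    proof eventually_elim
      case (elim y)
      let ?s = "y 0 + y 1"
      have "AE a in mu_beta \<gamma>. f (T_op 0 1 a y) = 0"
        using elim(1) by (subst (asm) nn_integral_0_iff_AE) (auto simp: f_def T_op_def)
      then have eq: "AE a in mu_beta \<gamma>. a = c / ?s"
        by eventually_elim (use elim(2) in \<open>auto simp: f_def T_op_def field_simps\<close>)
      have "AE a in mu_beta \<gamma>. a \<noteq> c / ?s"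
        unfolding mu_beta_eq[OF g] using AE_lborel_singleton[of "c / ?s"]
        by (subst AE_density) auto
      with eq have "AE a in mu_beta \<gamma>. False"
        by eventually_elim auto
      then show False
        by simp
    qed
    then show False
      by simp
  qed
  have test: "f \<in> test_fns \<gamma> (1 / 3) 3"
    using f f2 mean var by (simp add: test_fns_def)
  have D_le: "(\<integral>\<^sup>+ y. ennreal ((y i + y j) powr m * (D_op \<gamma> i j f y)\<^sup>2) \<partial>?nu) \<le> ennreal (\<integral>y. (f y)\<^sup>2 \<partial>?nu)"
    if ij: "i < 3" "j < 3" "i \<noteq> j" and s: "AE y in ?nu. 0 \<le> y i + y j \<and> y i + y j \<le> 1" for i j
  proof -
    have "(\<integral>\<^sup>+ y. ennreal ((y i + y j) powr m * (D_op \<gamma> i j f y)\<^sup>2) \<partial>?nu) \<le> (\<integral>\<^sup>+ y. ennreal ((D_op \<gamma> i j f y)\<^sup>2) \<partial>?nu)"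
    proof (rule nn_integral_mono_AE, use s in eventually_elim)
      case (elim y)
      have "(y i + y j) powr m \<le> 1"
        using elim m powr_mono2[of m "y i + y j" 1] by simp
      then show ?case
        by (intro ennreal_leI mult_left_le_one_le) auto
    qed
    also have "\<dots> \<le> (\<integral>\<^sup>+ y. ennreal ((f y)\<^sup>2) \<partial>?nu)"
      by (rule D_op_contraction[OF g ij f])
    finally show ?thesis
      using f2 by (simp add: nn_integral_eq_integral)
  qed
  have pos: "(\<integral>y. (f y)\<^sup>2 \<partial>?nu) > 0"
    using var by (simp add: less_le)
  have s01: "AE y in ?nu. 0 \<le> y 0 + y 1 \<and> y 0 + y 1 \<le> 1"
    and s12: "AE y in ?nu. 0 \<le> y 1 + y 2 \<and> y 1 + y 2 \<le> 1"
    using ae by (eventually_elim; simp)+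
  have "kappa \<gamma> m \<le> dir_nn \<gamma> m (1 / 3) 3 f / ennreal (\<integral>y. (f y)\<^sup>2 \<partial>?nu)"
    unfolding kappa_def gap_nn_def by (rule INF_lower[OF test])
  also have "\<dots> \<le> 2 * ennreal (\<integral>y. (f y)\<^sup>2 \<partial>?nu) / ennreal (\<integral>y. (f y)\<^sup>2 \<partial>?nu)"
    unfolding dir_nn_3 mult_2
    by (intro divide_right_mono_ennreal add_mono D_le s01 s12) simp_all
  also have "\<dots> = 2"
    using pos by (simp add: mult_divide_eq_ennreal)
  finally show ?thesis .
qed

subsection \<open>Comparison of the Dirichlet forms\<close>

text \<open>Dividing a pair anew commutes with scaling by the total of the triple. Sites
  \<open>i\<close>, \<open>j\<close>, \<open>l\<close> play the roles of 0, 1, 2, with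
  \<open>j\<close> in the middle of the chain.\<close>

lemma T_op_S_op:
  assumes "i \<noteq> j" "i \<noteq> l" "j \<noteq> l"
  shows "T_op i j a (S_op i j l y x) = S_op i j l (T_op 0 1 a y) x"
    and "T_op j l a (S_op i j l y x) = S_op i j l (T_op 1 2 a y) x"
  using assms by (auto simp: T_op_def S_op_def fun_eq_iff algebra_simps)

lemma S_op_apply:
  assumes "i \<noteq> j" "i \<noteq> l" "j \<noteq> l"
  shows "S_op i j l y x i = (x i + x j + x l) * y 0" "S_op i j l y x j = (x i + x j + x l) * y 1"
    "S_op i j l y x l = (x i + x j + x l) * y 2"
  using assms by (auto simp: S_op_def)

lemma D_op_S_op:
  assumes "i \<noteq> j" "i \<noteq> l" "j \<noteq> l"
  shows "D_op \<gamma> i j f (S_op i j l y x) = D_op \<gamma> 0 1 (\<lambda>y. f (S_op i j l y x)) y"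
    and "D_op \<gamma> j l f (S_op i j l y x) = D_op \<gamma> 1 2 (\<lambda>y. f (S_op i j l y x)) y"
  using assms by (simp_all add: D_op_def E_op_def T_op_S_op)

text \<open>Taken for ordered pairs, so that sums over ordered triples can be reindexed
  freely.\<close>

definition pair_form :: "real \<Rightarrow> real \<Rightarrow> real \<Rightarrow> nat \<Rightarrow> ((nat \<Rightarrow> real) \<Rightarrow> real) \<Rightarrow> nat \<Rightarrow> nat \<Rightarrow> ennreal" where
  "pair_form \<gamma> m \<E> N f i j = (\<integral>\<^sup>+ x. ennreal ((x i + x j) powr m * (D_op \<gamma> i j f x)\<^sup>2) \<partial>nu_cond \<gamma> \<E> N)"

lemma pair_form_commute:
  assumes "\<gamma> > 0" "i < N" "j < N" "i \<noteq> j" "f \<in> borel_measurable (cfg_space N)"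
  shows "pair_form \<gamma> m \<E> N f i j = pair_form \<gamma> m \<E> N f j i"
  unfolding pair_form_def
  by (intro nn_integral_cong) (simp add: D_op_commute[OF assms] add.commute)

text \<open>For almost every \<open>x\<close>, \<open>kappa_contraction\<close> is applied to
  \<open>f\<close> as a function of the three fractions. Multiplying by \<open>s powr m\<close>
  restores the true masses, and integrating over \<open>x\<close> removes the resampling by
  invariance.\<close>

lemma triple_inequality:
  assumes g: "\<gamma> > 0" and N: "i < N" "j < N" "l < N" and d: "i \<noteq> j" "i \<noteq> l" "j \<noteq> l"
    and f: "f \<in> borel_measurable (cfg_space N)"
    and fin: "(\<integral>\<^sup>+ x. ennreal ((f x)\<^sup>2) \<partial>nu_cond \<gamma> \<E> N) < \<infinity>"
  shows "kappa \<gamma> m * (\<integral>\<^sup>+ x. ennreal ((x i + x j + x l) powr m * (D_op \<gamma> i j f x)\<^sup>2) \<partial>nu_cond \<gamma> \<E> N)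
    \<le> pair_form \<gamma> m \<E> N f i j + pair_form \<gamma> m \<E> N f j l"
proof -
  let ?M = "nu_cond \<gamma> \<E> N"
  let ?nu = "nu_cond \<gamma> (1 / 3) 3"
  note [measurable] = f D_op_measurable[OF g N(1,2) f] D_op_measurable[OF g N(2,3) f]
    measurable_cfg_space_coord[OF N(1)] measurable_cfg_space_coord[OF N(2)] measurable_cfg_space_coord[OF N(3)]
  define A where "A x = ennreal ((x i + x j) powr m * (D_op \<gamma> i j f x)\<^sup>2)" for x
  define B where "B x = ennreal ((x j + x l) powr m * (D_op \<gamma> j l f x)\<^sup>2)" for x
  define C where "C x = ennreal ((x i + x j + x l) powr m * (D_op \<gamma> i j f x)\<^sup>2)" for x
  have A [measurable]: "A \<in> borel_measurable (cfg_space N)" 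
    and B [measurable]: "B \<in> borel_measurable (cfg_space N)" 
    and C [measurable]: "C \<in> borel_measurable (cfg_space N)"
    unfolding A_def B_def C_def by measurable
  have f2: "(\<lambda>x. ennreal ((f x)\<^sup>2)) \<in> borel_measurable (cfg_space N)"
    by measurable
  note resample = nn_integral_nu_resample3[OF g N d]
  \<comment> \<open>Square integrability of \<open>f\<close> passes to almost every triple fibre,
    again by invariance; \<open>kappa_contraction\<close> requires it.\<close>
  have ae_fin: "AE x in ?M. (\<integral>\<^sup>+ y. ennreal ((f (S_op i j l y x))\<^sup>2) \<partial>?nu) \<noteq> \<infinity>"
    using fin nn_integral_S_op_measurable[OF g N f2]
    by (intro nn_integral_noteq_infinite) (simp_all add: resample[OF f2])
  have ae_pos: "AE x in ?M. (\<forall>k<N. 0 < x k) \<and> (\<Sum>k<N. x k) = N * \<E>"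
    using N by (intro AE_nu_cond) auto
  have ae3: "AE y in ?nu. (\<forall>k<3. 0 < y k) \<and> (\<Sum>k<3. y k) = 1"
    using AE_nu_cond[of 3 "1 / 3" \<gamma>] by simp
  have ae3: "AE y in ?nu. 0 < y 0 \<and> 0 < y 1 \<and> 0 < y 2 \<and> y 0 + y 1 + y 2 = 1"
    using ae3 by eventually_elim (auto simp: numeral_3_eq_3 numeral_2_eq_2)
  have main: "AE x in ?M. kappa \<gamma> m * (\<integral>\<^sup>+ y. C (S_op i j l y x) \<partial>?nu) \<le>
    (\<integral>\<^sup>+ y. (A (S_op i j l y x) + B (S_op i j l y x)) \<partial>?nu)"
    using ae_fin ae_pos AE_space
  proof eventually_elim
    case (elim x)
    define s where "s = x i + x j + x l"
    have s: "s > 0"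
      using elim(2) N by (auto simp: s_def intro!: add_pos_pos)
    define h where "h y = f (S_op i j l y x)" for y
    have x: "x \<in> space (cfg_space N)"
      using elim(3) by simp
    have S: "(\<lambda>y. S_op i j l y x) \<in> cfg_space 3 \<rightarrow>\<^sub>M cfg_space N"
      by (rule S_op_measurable_param[OF N x])
    have h [measurable]: "h \<in> borel_measurable (cfg_space 3)"
      unfolding h_def using measurable_compose[OF S f] .
    have y [measurable]: "(\<lambda>y. y 0) \<in> borel_measurable (cfg_space 3)" "(\<lambda>y. y 1) \<in> borel_measurable (cfg_space 3)"
      "(\<lambda>y. y 2) \<in> borel_measurable (cfg_space 3)"
      by (rule measurable_cfg_space_coord; simp)+
    note [measurable] = D_op_measurable[OF g _ _ h, of 0 1, simplified] D_op_measurable[OF g _ _ h, of 1 2, simplified]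
       y(2)[simplified]
    have hfin: "(\<integral>\<^sup>+ y. ennreal ((h y)\<^sup>2) \<partial>?nu) < \<infinity>"
      using elim(1) by (simp add: h_def less_top)
    have sp: "ennreal (s powr m) * ennreal (r powr m * d) = ennreal ((s * r) powr m * d)" if "0 \<le> r" "0 \<le> d" for r d
      using s that by (simp add: powr_mult ennreal_mult[symmetric] mult.assoc)
    have "kappa \<gamma> m * (\<integral>\<^sup>+ y. C (S_op i j l y x) \<partial>?nu) =
        kappa \<gamma> m * (\<integral>\<^sup>+ y. ennreal (s powr m) * ennreal ((D_op \<gamma> 0 1 h y)\<^sup>2) \<partial>?nu)"
    proof (intro arg_cong2[where f = "(*)"] refl nn_integral_cong_AE, use ae3 in eventually_elim)
      case (elim y)
      \<comment> \<open>The weight in \<open>C\<close> is the total of the triple, which resampling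
        leaves equal to \<open>s\<close>; it is therefore a constant factor.\<close>
      have "s * y 0 + s * y 1 + s * y 2 = s"
        using elim by (metis distrib_left mult.right_neutral)
      then show ?case
        by (simp add: C_def S_op_apply[OF d] D_op_S_op[OF d] h_def[symmetric] s_def[symmetric] ennreal_mult')
    qed
    also have "\<dots> = ennreal (s powr m) * (kappa \<gamma> m * (\<integral>\<^sup>+ y. ennreal ((D_op \<gamma> 0 1 h y)\<^sup>2) \<partial>?nu))"
      by (subst nn_integral_cmult) (simp_all add: mult.left_commute)
    also have "\<dots> \<le> ennreal (s powr m) * dir_nn \<gamma> m (1 / 3) 3 h"
      by (intro mult_left_mono kappa_contraction[OF g h hfin]) simp
    also have "\<dots> = (\<integral>\<^sup>+ y. ennreal (s powr m) * ennreal ((y 0 + y 1) powr m * (D_op \<gamma> 0 1 h y)\<^sup>2) +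
        ennreal (s powr m) * ennreal ((y 1 + y 2) powr m * (D_op \<gamma> 1 2 h y)\<^sup>2) \<partial>?nu)"
      unfolding dir_nn_3 distrib_left
      by (subst nn_integral_add) (simp_all add: nn_integral_cmult)
    also have "\<dots> = (\<integral>\<^sup>+ y. (A (S_op i j l y x) + B (S_op i j l y x)) \<partial>?nu)"
    proof (intro nn_integral_cong_AE, use ae3 in eventually_elim)
      case (elim y)
      have "0 \<le> y 0 + y 1" "0 \<le> y 1 + y 2"
        using elim by auto
      then show ?case
        unfolding A_def B_def S_op_apply[OF d] D_op_S_op[OF d] h_def[symmetric] s_def[symmetric] distrib_left[of s, symmetric]
        by (simp add: sp)
    qed
    finally show ?case .
  qed
  have "kappa \<gamma> m * (\<integral>\<^sup>+ x. C x \<partial>?M) = (\<integral>\<^sup>+ x. kappa \<gamma> m * (\<integral>\<^sup>+ y. C (S_op i j l y x) \<partial>?nu) \<partial>?M)"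
    using nn_integral_S_op_measurable[OF g N C] by (simp add: nn_integral_cmult resample[OF C])
  also have "\<dots> \<le> (\<integral>\<^sup>+ x. \<integral>\<^sup>+ y. (A (S_op i j l y x) + B (S_op i j l y x)) \<partial>?nu \<partial>?M)"
    by (rule nn_integral_mono_AE[OF main])
  also have "\<dots> = (\<integral>\<^sup>+ x. (A x + B x) \<partial>?M)"
    using resample[of "\<lambda>x. A x + B x"] by simp
  also have "\<dots> = pair_form \<gamma> m \<E> N f i j + pair_form \<gamma> m \<E> N f j l"
    unfolding pair_form_def A_def[symmetric] B_def[symmetric] by (intro nn_integral_add) simp_all
  finally show ?thesis
    unfolding C_def .
qed

section \<open>Convexity and the sum over triples\<close>

lemma powr_ge_tangent:
  fixes E t m :: real
  assumes "m \<ge> 1" "E > 0" "t \<ge> 0"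
  shows "t powr m \<ge> E powr m + m * E powr (m - 1) * (t - E)"
\<comment> \<open>The tangent argument lives on the open half-line. At the end point the power is 0
  and the tangent has the value \<open>(1 - m) * E powr m\<close>, which is nonpositive.\<close>
proof (cases "t = 0")
  case True
  have "E powr (m - 1) * E = E powr m"
    using assms powr_mult_base[of E "m - 1"] by (simp add: mult.commute)
  then have "E powr m + m * E powr (m - 1) * (t - E) = (1 - m) * E powr m"
    using True by (simp add: algebra_simps)
  also have "\<dots> \<le> 0"
    using assms by (simp add: mult_nonpos_nonneg)
  finally show ?thesis
    using True by simp
next
  case False
  have "((\<lambda>t. t powr m) has_field_derivative m * x powr (m - 1)) (at x within {0<..})" if "x \<in> {0<..}" for x
    using that by (auto intro!: derivative_eq_intros)
  then have "t powr m - E powr m \<ge> (m * E powr (m - 1)) * (t - E)"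
    using assms False powr_convex[of m]
    by (intro convex_on_imp_above_tangent[where A = "{0<..}"]) (auto intro: convex_on_subset simp: interior_open)
  then show ?thesis
    by simp
qed

text \<open>Tangents at \<open>\<E>\<close> are summed over the third site. Their linear parts add
  up to a nonnegative multiple of \<open>real (N - 3) * (x i + x j) + 2 * \<E>\<close>: on average,
  a triple containing the given pair has total at least \<open>\<E>\<close>.\<close>

lemma sum_powr_triples_ge:
  fixes x :: "nat \<Rightarrow> real"
  assumes m: "m \<ge> 1" and E: "\<E> > 0" and ij: "i < N" "j < N" "i \<noteq> j" and N: "N \<ge> 3"
    and pos: "\<forall>k<N. 0 < x k" and sum: "(\<Sum>k<N. x k) = N * \<E>"
  shows "real (N - 2) * \<E> powr m \<le> (\<Sum>l\<in>{..<N} - {i, j}. (x i + x j + x l) powr m)"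
proof -
  let ?K = "{..<N} - {i, j}"
  have card: "card ?K = N - 2"
    using ij by (subst card_Diff_subset) auto
  have sumK: "(\<Sum>l\<in>?K. x l) = N * \<E> - x i - x j"
    using ij sum by (subst sum_diff) auto
  have "(\<Sum>l\<in>?K. x i + x j + x l - \<E>) = real (N - 2) * (x i + x j) + (N * \<E> - x i - x j) - real (N - 2) * \<E>"
    by (simp only: sum.distrib sum_subtractf sum_constant card sumK) (simp add: distrib_left)
  also have "\<dots> = real (N - 3) * (x i + x j) + 2 * \<E>"
    using N by (simp add: of_nat_diff algebra_simps)
  also have "\<dots> \<ge> 0"
    using pos ij E by (intro add_nonneg_nonneg mult_nonneg_nonneg) (auto simp: less_imp_le)
  finally have ge0: "(\<Sum>l\<in>?K. x i + x j + x l - \<E>) \<ge> 0" .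
  have "real (N - 2) * \<E> powr m \<le> real (N - 2) * \<E> powr m + m * \<E> powr (m - 1) * (\<Sum>l\<in>?K. x i + x j + x l - \<E>)"
    using m ge0 by simp
  also have "\<dots> = (\<Sum>l\<in>?K. \<E> powr m + m * \<E> powr (m - 1) * (x i + x j + x l - \<E>))"
    by (simp only: sum.distrib sum_constant card sum_distrib_left)
  also have "\<dots> \<le> (\<Sum>l\<in>?K. (x i + x j + x l) powr m)"
    using pos ij by (intro sum_mono powr_ge_tangent m E) (auto intro!: add_nonneg_nonneg simp: less_imp_le)
  finally show ?thesis .
qed

lemma sum_offdiag_symmetric:
  fixes a :: "nat \<Rightarrow> nat \<Rightarrow> ennreal"
  assumes "\<And>i j. i < N \<Longrightarrow> j < N \<Longrightarrow> i \<noteq> j \<Longrightarrow> a i j = a j i"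
  shows "(\<Sum>(i, j)\<in>{(i, j). i < N \<and> j < N \<and> i \<noteq> j}. a i j) = 2 * (\<Sum>(i, j)\<in>{(i, j). i < j \<and> j < N}. a i j)"
proof -
  let ?Q = "{(i, j). i < j \<and> j < N}" and ?R = "{(i, j). j < i \<and> i < N}"
  have fin: "finite ?Q" "finite ?R"
    by (rule finite_subset[of _ "{..<N} \<times> {..<N}"]; auto)+
  have "{(i, j). i < N \<and> j < N \<and> i \<noteq> j} = ?Q \<union> ?R"
    by auto
  moreover have "(\<Sum>(i, j)\<in>?Q \<union> ?R. a i j) = (\<Sum>(i, j)\<in>?Q. a i j) + (\<Sum>(i, j)\<in>?R. a i j)"
    by (rule sum.union_disjoint) (use fin in auto)
  moreover have "(\<Sum>(i, j)\<in>?R. a i j) = (\<Sum>(i, j)\<in>?Q. a i j)"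
    by (rule sum.reindex_bij_witness[of _ "\<lambda>(i, j). (j, i)" "\<lambda>(i, j). (j, i)"]) (auto intro: assms)
  ultimately show ?thesis
    by (simp add: mult_2)
qed

lemma triple_sum_bound:
  assumes g: "\<gamma> > 0" and m: "m \<ge> 1" and E: "\<E> > 0" and N: "N \<ge> 3"
    and f: "f \<in> borel_measurable (cfg_space N)"
    and fin: "(\<integral>\<^sup>+ x. ennreal ((f x)\<^sup>2) \<partial>nu_cond \<gamma> \<E> N) < \<infinity>"
  defines "P \<equiv> {(i, j). i < N \<and> j < N \<and> i \<noteq> j}"
  shows "kappa \<gamma> m * ennreal (\<E> powr m) * (\<Sum>(i, j)\<in>P. \<integral>\<^sup>+ x. ennreal ((D_op \<gamma> i j f x)\<^sup>2) \<partial>nu_cond \<gamma> \<E> N)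
    \<le> 2 * (\<Sum>(i, j)\<in>P. pair_form \<gamma> m \<E> N f i j)"
proof -
  let ?M = "nu_cond \<gamma> \<E> N"
  let ?a = "pair_form \<gamma> m \<E> N f"
  let ?K = "\<lambda>i j. {..<N} - {i, j}"
  define b where "b i j = (\<integral>\<^sup>+ x. ennreal ((D_op \<gamma> i j f x)\<^sup>2) \<partial>?M)" for i j
  define c where "c i j l = (\<integral>\<^sup>+ x. ennreal ((x i + x j + x l) powr m * (D_op \<gamma> i j f x)\<^sup>2) \<partial>?M)" for i j l
  have finP: "finite P"
    unfolding P_def by (rule finite_subset[of _ "{..<N} \<times> {..<N}"]) auto
  have card: "card (?K i j) = N - 2" if "(i, j) \<in> P" for i j
    using that by (subst card_Diff_subset) (auto simp: P_def)
  have ae: "AE x in ?M. (\<forall>k<N. 0 < x k) \<and> (\<Sum>k<N. x k) = N * \<E>"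
    using N by (intro AE_nu_cond) auto
  have bc: "ennreal (real (N - 2)) * (ennreal (\<E> powr m) * b i j) \<le> (\<Sum>l\<in>?K i j. c i j l)" if "(i, j) \<in> P" for i j
  proof -
    have ij: "i < N" "j < N" "i \<noteq> j"
      using that by (auto simp: P_def)
    note meas = D_op_measurable[OF g ij(1,2) f]
    have "ennreal (real (N - 2)) * (ennreal (\<E> powr m) * b i j) =
        (\<integral>\<^sup>+ x. ennreal (real (N - 2) * \<E> powr m * (D_op \<gamma> i j f x)\<^sup>2) \<partial>?M)"
      using meas unfolding b_def by (simp add: ennreal_mult' mult.assoc nn_integral_cmult)
    also have "\<dots> \<le> (\<integral>\<^sup>+ x. (\<Sum>l\<in>?K i j. ennreal ((x i + x j + x l) powr m * (D_op \<gamma> i j f x)\<^sup>2)) \<partial>?M)"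
    proof (rule nn_integral_mono_AE, use ae in eventually_elim)
      case (elim x)
      then have "real (N - 2) * \<E> powr m * (D_op \<gamma> i j f x)\<^sup>2 \<le>
          (\<Sum>l\<in>?K i j. (x i + x j + x l) powr m) * (D_op \<gamma> i j f x)\<^sup>2"
        by (intro mult_right_mono sum_powr_triples_ge m E ij N) auto
      then show ?case
        by (simp add: sum_distrib_right ennreal_leI)
    qed
    also have "\<dots> = (\<Sum>l\<in>?K i j. c i j l)"
      unfolding c_def
    proof (rule nn_integral_sum)
      fix l assume "l \<in> ?K i j"
      then have "l < N"
        by auto
      note [measurable] = meas measurable_cfg_space_coord[OF ij(1)] measurable_cfg_space_coord[OF ij(2)]
        measurable_cfg_space_coord[OF this]
      show "(\<lambda>x. ennreal ((x i + x j + x l) powr m * (D_op \<gamma> i j f x)\<^sup>2)) \<in> borel_measurable ?M"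
        unfolding borel_measurable_nu_cond by measurable
    qed
    finally show ?thesis .
  qed
  have "ennreal (real (N - 2)) * (kappa \<gamma> m * ennreal (\<E> powr m) * (\<Sum>(i, j)\<in>P. b i j)) =
      kappa \<gamma> m * (\<Sum>(i, j)\<in>P. ennreal (real (N - 2)) * (ennreal (\<E> powr m) * b i j))"
    by (simp add: sum_distrib_left case_prod_unfold mult_ac)
  also have "\<dots> \<le> kappa \<gamma> m * (\<Sum>(i, j)\<in>P. \<Sum>l\<in>?K i j. c i j l)"
    by (intro mult_left_mono sum_mono) (auto intro: bc)
  also have "\<dots> = (\<Sum>(i, j)\<in>P. \<Sum>l\<in>?K i j. kappa \<gamma> m * c i j l)"
    by (simp add: sum_distrib_left case_prod_unfold)
  also have "\<dots> \<le> (\<Sum>(i, j)\<in>P. \<Sum>l\<in>?K i j. ?a i j + ?a j l)"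
    unfolding c_def case_prod_unfold
    by (intro sum_mono triple_inequality[OF g _ _ _ _ _ _ f fin]) (auto simp: P_def)
  also have "\<dots> = (\<Sum>(i, j)\<in>P. \<Sum>l\<in>?K i j. ?a i j) + (\<Sum>(i, j)\<in>P. \<Sum>l\<in>?K i j. ?a j l)"
    by (simp add: sum.distrib case_prod_unfold)
  also have "(\<Sum>(i, j)\<in>P. \<Sum>l\<in>?K i j. ?a j l) = (\<Sum>(i, j)\<in>P. \<Sum>l\<in>?K i j. ?a i j)"
  proof -
    have "(\<Sum>(i, j)\<in>P. \<Sum>l\<in>?K i j. ?a j l) = (\<Sum>((i, j), l)\<in>(SIGMA p:P. ?K (fst p) (snd p)). ?a j l)"
      using finP by (simp add: sum.Sigma case_prod_unfold)
    also have "\<dots> = (\<Sum>((i, j), l)\<in>(SIGMA p:P. ?K (fst p) (snd p)). ?a i j)"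
      \<comment> \<open>Reading a triple backwards keeps the middle site and turns the bond from
        \<open>j\<close> to \<open>l\<close> into the bond from \<open>j\<close> to
        \<open>i\<close>, which symmetry identifies with the first one.\<close>
      by (rule sum.reindex_bij_witness[of _ "\<lambda>((i, j), l). ((l, j), i)" "\<lambda>((i, j), l). ((l, j), i)"])
         (auto simp: P_def intro!: pair_form_commute g f)
    also have "\<dots> = (\<Sum>(i, j)\<in>P. \<Sum>l\<in>?K i j. ?a i j)"
      unfolding case_prod_unfold
      by (rule sum.Sigma[symmetric, OF finP, unfolded case_prod_unfold]) simp
    finally show ?thesis .
  qed
  also have "(\<Sum>(i, j)\<in>P. \<Sum>l\<in>?K i j. ?a i j) = (\<Sum>(i, j)\<in>P. ennreal (real (N - 2)) * ?a i j)"
    by (intro sum.cong refl) (auto simp: card ennreal_of_nat_eq_real_of_nat)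
  also have "\<dots> = ennreal (real (N - 2)) * (\<Sum>(i, j)\<in>P. ?a i j)"
    by (simp add: sum_distrib_left case_prod_unfold)
  finally have "ennreal (real (N - 2)) * (kappa \<gamma> m * ennreal (\<E> powr m) * (\<Sum>(i, j)\<in>P. b i j)) \<le>
      ennreal (real (N - 2)) * (2 * (\<Sum>(i, j)\<in>P. ?a i j))"
    by (simp add: mult_2 distrib_left)
  then show ?thesis
    using N unfolding b_def by (subst (asm) ennreal_mult_le_mult_iff) auto
qed

lemma dir_lr_eq:
  "dir_lr \<gamma> m \<E> N f = ennreal (1 / real N) * (\<Sum>(i, j)\<in>{(i, j). i < j \<and> j < N}. pair_form \<gamma> m \<E> N f i j)"
  by (simp add: dir_lr_def pair_form_def)

text \<open>Only an inequality, since \<open>0 powr 0\<close> is 0 and not 1. It points the right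
  way, as the form with exponent 0 stands on the smaller side of the final estimate.\<close>

lemma dir_lr_0_le:
  "dir_lr \<gamma> 0 \<E> N f \<le> ennreal (1 / real N) *
    (\<Sum>(i, j)\<in>{(i, j). i < j \<and> j < N}. \<integral>\<^sup>+ x. ennreal ((D_op \<gamma> i j f x)\<^sup>2) \<partial>nu_cond \<gamma> \<E> N)"
  unfolding dir_lr_def case_prod_unfold
  by (intro mult_left_mono sum_mono nn_integral_mono ennreal_leI mult_left_le_one_le) auto

lemma pair_sum_bound:
  assumes g: "\<gamma> > 0" and m: "m \<ge> 1" and E: "\<E> > 0" and N: "N \<ge> 2"
    and f: "f \<in> borel_measurable (cfg_space N)"
    and fin: "(\<integral>\<^sup>+ x. ennreal ((f x)\<^sup>2) \<partial>nu_cond \<gamma> \<E> N) < \<infinity>"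
  defines "Q \<equiv> {(i, j). i < j \<and> j < N}"
  shows "ennreal (\<E> powr m / 2) * kappa \<gamma> m * (\<Sum>(i, j)\<in>Q. \<integral>\<^sup>+ x. ennreal ((D_op \<gamma> i j f x)\<^sup>2) \<partial>nu_cond \<gamma> \<E> N)
    \<le> (\<Sum>(i, j)\<in>Q. pair_form \<gamma> m \<E> N f i j)"
proof (cases "N = 2")
  case True
  have Q: "Q = {(0, 1)}"
    using True by (auto simp: Q_def)
  define b where "b = (\<integral>\<^sup>+ x. ennreal ((D_op \<gamma> 0 1 f x)\<^sup>2) \<partial>nu_cond \<gamma> \<E> N)"
  have ae: "AE x in nu_cond \<gamma> \<E> N. x 0 + x 1 = 2 * \<E>"
    using AE_nu_cond[of N \<E> \<gamma>] True by (auto simp: numeral_2_eq_2)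
  have meas: "D_op \<gamma> 0 1 f \<in> borel_measurable (cfg_space N)"
    using True by (intro D_op_measurable g f) auto
  have "pair_form \<gamma> m \<E> N f 0 1 = (\<integral>\<^sup>+ x. ennreal ((2 * \<E>) powr m) * ennreal ((D_op \<gamma> 0 1 f x)\<^sup>2) \<partial>nu_cond \<gamma> \<E> N)"
    unfolding pair_form_def by (intro nn_integral_cong_AE, use ae in eventually_elim) (simp add: ennreal_mult')
  also have "\<dots> = ennreal ((2 * \<E>) powr m) * b"
    using meas unfolding b_def by (intro nn_integral_cmult) simp
  finally have pf: "pair_form \<gamma> m \<E> N f 0 1 = ennreal ((2 * \<E>) powr m) * b" .
  \<comment> \<open>With two sites the pair carries the whole mass, so its weight is the constant
    \<open>(2 * \<E>) powr m\<close>. Replacing \<open>kappa\<close> by 2 leaves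
    \<open>\<E> powr m\<close>, which is smaller.\<close>
  have "ennreal (\<E> powr m / 2) * kappa \<gamma> m * b \<le> ennreal (\<E> powr m / 2) * 2 * b"
    using g m by (intro mult_right_mono mult_left_mono kappa_le_2) auto
  also have "ennreal (\<E> powr m / 2) * 2 = ennreal (\<E> powr m)"
    by (subst ennreal_numeral[symmetric]) (subst ennreal_mult''[symmetric], simp_all)
  also have "ennreal (\<E> powr m) * b \<le> ennreal ((2 * \<E>) powr m) * b"
    using m E by (intro mult_right_mono ennreal_leI powr_mono2) auto
  finally show ?thesis
    using pf by (simp add: Q b_def)
next
  case False
  let ?P = "{(i, j). i < N \<and> j < N \<and> i \<noteq> j}"
  define b where "b i j = (\<integral>\<^sup>+ x. ennreal ((D_op \<gamma> i j f x)\<^sup>2) \<partial>nu_cond \<gamma> \<E> N)" for i j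
  have b_sym: "b i j = b j i" if "i < N" "j < N" "i \<noteq> j" for i j
    unfolding b_def by (intro nn_integral_cong) (simp add: D_op_commute[OF g that f])
  have sum_b: "(\<Sum>(i, j)\<in>?P. b i j) = 2 * (\<Sum>(i, j)\<in>Q. b i j)"
    unfolding Q_def by (rule sum_offdiag_symmetric, rule b_sym)
  have sum_pair: "(\<Sum>(i, j)\<in>?P. pair_form \<gamma> m \<E> N f i j) = 2 * (\<Sum>(i, j)\<in>Q. pair_form \<gamma> m \<E> N f i j)"
    unfolding Q_def by (rule sum_offdiag_symmetric, rule pair_form_commute[OF g _ _ _ f])
  have N3: "N \<ge> 3"
    using N False by simp
  \<comment> \<open>Each side yields a factor 4: a 2 from passing to unordered pairs, and a further
    2, on the left from halving \<open>\<E> powr m\<close> and on the right from the two bonds of a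
    triple.\<close>
  have half: "ennreal (\<E> powr m) = 2 * ennreal (\<E> powr m / 2)"
    by (subst ennreal_numeral[symmetric]) (subst ennreal_mult''[symmetric], simp_all)
  have four: "4 = 2 * (2 :: ennreal)"
    by simp
  have "kappa \<gamma> m * ennreal (\<E> powr m) * (\<Sum>(i, j)\<in>?P. b i j) \<le> 2 * (\<Sum>(i, j)\<in>?P. pair_form \<gamma> m \<E> N f i j)"
    using triple_sum_bound[OF g m E N3 f fin] unfolding b_def .
  then have "kappa \<gamma> m * ennreal (\<E> powr m) * (2 * (\<Sum>(i, j)\<in>Q. b i j)) \<le> 2 * (2 * (\<Sum>(i, j)\<in>Q. pair_form \<gamma> m \<E> N f i j))"
    by (simp only: sum_b sum_pair)
  then have "4 * (ennreal (\<E> powr m / 2) * kappa \<gamma> m * (\<Sum>(i, j)\<in>Q. b i j)) \<le> 4 * (\<Sum>(i, j)\<in>Q. pair_form \<gamma> m \<E> N f i j)"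
    unfolding half four by (simp only: mult_ac)
  then show ?thesis
    unfolding b_def by (subst (asm) ennreal_mult_le_mult_iff) auto
qed

theorem theorem3:
  fixes \<gamma> m \<E> :: real and N :: nat
  assumes "\<gamma> > 0" and "m \<ge> 1" and "\<E> > 0" and "N \<ge> 2"
  shows "gap_lr \<gamma> m \<E> N \<ge> ennreal (\<E> powr m / 2) * kappa \<gamma> m * gap_lr \<gamma> 0 \<E> N"
  unfolding gap_lr_def[of \<gamma> m]
proof (rule INF_greatest)
  \<comment> \<open>Both infima run over the same test functions, whatever the exponent, so the two
    forms are compared at a single \<open>f\<close>.\<close>
  fix f assume f: "f \<in> test_fns \<gamma> \<E> N"
  let ?C = "ennreal (\<E> powr m / 2) * kappa \<gamma> m"
  let ?v = "ennreal (\<integral>x. (f x)\<^sup>2 \<partial>nu_cond \<gamma> \<E> N)"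
  have meas: "f \<in> borel_measurable (cfg_space N)" and L2: "integrable (nu_cond \<gamma> \<E> N) (\<lambda>x. (f x)\<^sup>2)"
    using f by (auto simp: test_fns_def)
  have fin: "(\<integral>\<^sup>+ x. ennreal ((f x)\<^sup>2) \<partial>nu_cond \<gamma> \<E> N) < \<infinity>"
    using L2 by (simp add: nn_integral_eq_integral)
  have "?C * dir_lr \<gamma> 0 \<E> N f \<le> ?C * (ennreal (1 / real N) *
    (\<Sum>(i, j)\<in>{(i, j). i < j \<and> j < N}. \<integral>\<^sup>+ x. ennreal ((D_op \<gamma> i j f x)\<^sup>2) \<partial>nu_cond \<gamma> \<E> N))"
    by (intro mult_left_mono dir_lr_0_le) simp
  also have "\<dots> \<le> dir_lr \<gamma> m \<E> N f"
    unfolding dir_lr_eq mult.left_commute[of ?C]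
    by (intro mult_left_mono pair_sum_bound assms meas fin) simp
  finally have dir: "?C * dir_lr \<gamma> 0 \<E> N f \<le> dir_lr \<gamma> m \<E> N f" .
  have "?C * gap_lr \<gamma> 0 \<E> N \<le> ?C * (dir_lr \<gamma> 0 \<E> N f / ?v)"
    unfolding gap_lr_def by (intro mult_left_mono INF_lower f) simp
  also have "\<dots> = ?C * dir_lr \<gamma> 0 \<E> N f / ?v"
    by (simp add: ennreal_times_divide)
  also have "\<dots> \<le> dir_lr \<gamma> m \<E> N f / ?v"
    by (rule divide_right_mono_ennreal[OF dir])
  finally show "?C * gap_lr \<gamma> 0 \<E> N \<le> dir_lr \<gamma> m \<E> N f / ?v" .
qed

end
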